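(* The following hold for subsets of $\omega^\omega\times\omega^\omega$. (1) There is a total analytic set $A$ with compact homogeneous sections such that any total analytic set with compact sections is $\leq_1$-reducible to $A$. (2) For any total analytic set $A$ with closed sections, there is a total analytic set with homogeneous sections which is not $\leq_2$-reducible to $A$. (3) There is a total $F_{\sigma\delta}$ set with $G_\delta$ sections which is not $\equiv_2$-equivalent to any analytic set with closed sections. (4) There is a total closed set which is not $\leq_2$-reducible to any total analytic set with homogeneous sections.
   Context: For $A\subseteq X\times Y$ and $x\in X$, the $x$-th section is $A(x)=\{y\in Y:(x,y)\in A\}$. $A$ is total if all its sections are nonempty. A property of sections (compact, closed, $G_\delta$, homogeneous) is required of every section $A(x)$. A partial function $g$ from $X$ to $Y$ is a choice (function) for $A$ if $g(x)$ is defined and $g(x)\in A(x)$ whenever $A(x)\neq\emptyset$. A set $H\subseteq Z^Y$ is homogeneous if it is the set of all total choice functions for some $A\subseteq Y\times Z$; thus a subset of $\omega^\omega$ is homogeneous iff it is of the form $\prod_{n\in\omega}A_n$ with nonempty $A_n\subseteq\omega$. For $A\subseteq X\times Y$ and $B\subseteq Z\times W$: $A\leq_1B$ if there are continuous functions $h\colon X\to Z$ and $k\colon W\to Y$ such that $k\circ g\circ h$ is a choice for $A$ whenever $g$ is a choice for $B$. $A\leq_2B$ if there are continuous functions $h\colon X\to Z$ and $k$ (defined on $X\times W$ with values in $Y$) such that $x\mapsto k(x,g(h(x)))$ is a choice for $A$ whenever $g$ is a choice for $B$. As usual for realizers, the outer continuous function $k$ may be partial, provided it is defined on the relevant inputs.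 $A\equiv_2B$ means $A\leq_2B$ and $B\leq_2A$. *)

theory Defs
  imports "HOL-Analysis.Analysis"
begin

(* Baire space. Function_Topology equips it with the product topology of the discrete type nat. *)
type_synonym baire = "nat \<Rightarrow> nat"

abbreviation sect :: "('x \<times> 'y) set \<Rightarrow> 'x \<Rightarrow> 'y set" where
  "sect A x \<equiv> A `` {x}"

definition total_set :: "('x \<times> 'y) set \<Rightarrow> bool" where
  "total_set A \<longleftrightarrow> (\<forall>x. sect A x \<noteq> {})"

definition has_sections :: "('y set \<Rightarrow> bool) \<Rightarrow> ('x \<times> 'y) set \<Rightarrow> bool" where
  "has_sections P A \<longleftrightarrow> (\<forall>x. P (sect A x))"

(* Choice functions are partial and need not be continuous or measurable; outside the domain
   of A they may be undefined or take arbitrary values. *)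
definition is_choice :: "('x \<times> 'y) set \<Rightarrow> ('x \<rightharpoonup> 'y) \<Rightarrow> bool" where
  "is_choice A g \<longleftrightarrow> (\<forall>x. sect A x \<noteq> {} \<longrightarrow> (\<exists>y. g x = Some y \<and> y \<in> sect A x))"

definition homogeneous :: "('y \<Rightarrow> 'z) set \<Rightarrow> bool" where
  "homogeneous H \<longleftrightarrow> (\<exists>A :: ('y \<times> 'z) set. H = {f. is_choice A (\<lambda>y. Some (f y))})"

lemma homogeneous_iff_product:
  "homogeneous H \<longleftrightarrow> (\<exists>S. (\<forall>n. S n \<noteq> {}) \<and> H = {f. \<forall>n. f n \<in> S n})"
proof
  assume "homogeneous H"
  then obtain A where A: "H = {f. is_choice A (\<lambda>y. Some (f y))}"
    unfolding homogeneous_def by blast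
  define S where "S n = (if sect A n = {} then UNIV else sect A n)" for n
  have "\<forall>n. S n \<noteq> {}" by (simp add: S_def)
  moreover have "H = {f. \<forall>n. f n \<in> S n}"
    unfolding A is_choice_def S_def by auto
  ultimately show "\<exists>S. (\<forall>n. S n \<noteq> {}) \<and> H = {f. \<forall>n. f n \<in> S n}" by blast
next
  assume "\<exists>S. (\<forall>n. S n \<noteq> {}) \<and> H = {f. \<forall>n. f n \<in> S n}"
  then obtain S where S: "\<forall>n. S n \<noteq> {}" "H = {f. \<forall>n. f n \<in> S n}" by blast
  have "sect (Sigma UNIV S) n = S n" for n by auto
  then have "H = {f. is_choice (Sigma UNIV S) (\<lambda>y. Some (f y))}"
    using S by (simp add: is_choice_def)
  then show "homogeneous H" unfolding homogeneous_def by blast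
qed

(* Boldface Sigma^1_1, for subsets of a Polish space: projection of a closed subset
   of the product with Baire space. *)
definition analytic :: "'a::topological_space set \<Rightarrow> bool" where
  "analytic S \<longleftrightarrow> (\<exists>F :: ('a \<times> baire) set. closed F \<and> S = fst ` F)"

definition f_sigma_delta :: "'a::topological_space set \<Rightarrow> bool" where
  "f_sigma_delta S \<longleftrightarrow> (\<exists>F :: nat \<Rightarrow> 'a set. (\<forall>n. fsigma (F n)) \<and> S = (\<Inter>n. F n))"

(* A partial function that is continuous on its (arbitrary) domain. *)
definition partial_continuous ::
    "('a::topological_space \<rightharpoonup> 'b::topological_space) \<Rightarrow> bool" where
  "partial_continuous k \<longleftrightarrow> continuous_on (dom k) (\<lambda>x. the (k x))"

(* In both reducibilities the inner function h is total, while the outer function k may be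
   partial. If g (h x), or k at the resulting argument, is undefined, then so is the composite
   at x, and is_choice rejects it whenever the section of A at x is nonempty. This is what forces
   k to be defined on the relevant inputs. *)
definition reducible1 ::
    "('x::topological_space \<times> 'y::topological_space) set \<Rightarrow>
     ('z::topological_space \<times> 'w::topological_space) set \<Rightarrow> bool"
    (infix "\<le>\<^sub>1" 50) where
  "A \<le>\<^sub>1 B \<longleftrightarrow>
     (\<exists>(h :: 'x \<Rightarrow> 'z) (k :: 'w \<rightharpoonup> 'y).
        continuous_on UNIV h \<and> partial_continuous k \<and>
        (\<forall>g. is_choice B g \<longrightarrow> is_choice A (\<lambda>x. Option.bind (g (h x)) k)))"

definition reducible2 ::
    "('x::topological_space \<times> 'y::topological_space) set \<Rightarrow>
     ('z::topological_space \<times> 'w::topological_space) set \<Rightarrow> bool"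
    (infix "\<le>\<^sub>2" 50) where
  "A \<le>\<^sub>2 B \<longleftrightarrow>
     (\<exists>(h :: 'x \<Rightarrow> 'z) (k :: 'x \<times> 'w \<rightharpoonup> 'y).
        continuous_on UNIV h \<and> partial_continuous k \<and>
        (\<forall>g. is_choice B g \<longrightarrow> is_choice A (\<lambda>x. Option.bind (g (h x)) (\<lambda>w. k (x, w)))))"

definition equivalent2 ::
    "('x::topological_space \<times> 'y::topological_space) set \<Rightarrow>
     ('z::topological_space \<times> 'w::topological_space) set \<Rightarrow> bool"
    (infix "\<equiv>\<^sub>2" 50) where
  "A \<equiv>\<^sub>2 B \<longleftrightarrow> A \<le>\<^sub>2 B \<and> B \<le>\<^sub>2 A"

end

theory Submission
  imports Defs
begin

text \<open>Every set below is obtained from continuous partial functions and families of trees on \<open>\<nat>\<close> that are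
coded by the points of Baire space themselves, and each part rests on one idea.

Part 1 (\<open>universal_compact_sections\<close>). Of two trees, one always maps into the other by a
length-preserving monotone map (\<open>tree_le_total\<close>: the game in which one player climbs the first tree and the other
has to follow in the second is closed, hence determined). Such a map carries branches to branches, so if
at least one of the two trees is ill-founded, a tree that receives a map from the other is ill-founded. Thus
``name one of these two trees that receives a map from the other'' is an analytic question with
finitely many answers that is solvable for all pairs of trees, and it produces an ill-founded tree
whenever there is one. A point of a nonempty compact analytic set is found by asking, for each stem
\<open>s\<close> and number \<open>n\<close>, whether the next entry is \<open>n\<close> or larger; compactness guarantees that
``larger'' is not the answer for ever.

Part 2 (\<open>homogeneous_set_not_below\<close>). Given \<open>A\<close>, a point \<open>x\<close> codes a candidate reduction \<open>(h, k)\<close>, and the section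
of \<open>B\<close> at \<open>x\<close> asks for a number above \<open>k(x, w)(0)\<close> for some \<open>w \<in> A(h(x))\<close>. The \<open>w\<close> that
minimizes this number refutes the reduction.

Part 3 (\<open>gdelta_set_not_equivalent_to_closed_sections\<close>). If all sections of a
total set \<open>A\<close> are dense and \<open>A\<close> is equivalent
to a set with closed sections, then a continuous choice for \<open>A\<close> exists: the map from a section of \<open>A\<close> to a closed
section of \<open>B\<close> may be evaluated along any sequence of finite stems that decides its values, and this
search is continuous (\<open>dense_selection\<close>). But the set of all \<open>(x, y)\<close> such that \<open>y\<close> differs
infinitely often from the value at \<open>x\<close> of the function coded by \<open>x\<close> has dense \<open>G\<^sub>\<delta>\<close> sections and no
continuous choice.

Part 4 (\<open>hard_set_total\<close> and \<open>hard_set_not_reducible\<close>). Here \<open>x\<close> codes,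
besides \<open>k\<close>, a tree that witnesses membership in \<open>B(h(x))\<close>. The trick of
part 2 is applied locally, to the members of \<open>B(h(x))\<close> with a given stem \<open>s\<close> on which \<open>k\<close> has
a known first entry \<open>j < 2\<close>. The obstacle is that \<open>x\<close> may code an empty section, whereas the set must be
total. The witness trees of \<open>s\<close> and of the single entries are compared by \<open>\<preceq>\<close>, and it can be arranged that
at most one stem makes an unsolvable demand; as that demand concerns only one value of \<open>j\<close>, the other
value of \<open>j\<close> leaves a solution. If \<open>B(h(x))\<close> is homogeneous and nonempty, a sequence whose single
entries are witnessed belongs to \<open>B(h(x))\<close>, and the minimizing argument goes through.\<close>

section \<open>Locally constant functions\<close>

text \<open>Continuity into a discrete space, for ranges that carry no topology. All conditions on
finitely many entries of a point are locally constant predicates, hence clopen.\<close>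

definition locally_constant_on :: "'a::topological_space set \<Rightarrow> ('a \<Rightarrow> 'b) \<Rightarrow> bool" where
  "locally_constant_on X f \<longleftrightarrow> (\<forall>x\<in>X. \<forall>\<^sub>F y in at x within X. f y = f x)"

abbreviation locally_constant :: "('a::topological_space \<Rightarrow> 'b) \<Rightarrow> bool" where
  "locally_constant \<equiv> locally_constant_on UNIV"

lemma locally_constant_const: "locally_constant_on X (\<lambda>x. c)"
  by (simp add: locally_constant_on_def)

lemma locally_constant_map: "locally_constant_on X f \<Longrightarrow> locally_constant_on X (\<lambda>x. h (f x))"
  unfolding locally_constant_on_def by (auto elim!: eventually_mono)

lemma locally_constant_map2:
  assumes "locally_constant_on X f" "locally_constant_on X g"
  shows "locally_constant_on X (\<lambda>x. h (f x) (g x))"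
  unfolding locally_constant_on_def
proof
  fix x assume "x \<in> X"
  with assms have "\<forall>\<^sub>F y in at x within X. f y = f x" "\<forall>\<^sub>F y in at x within X. g y = g x"
    by (auto simp: locally_constant_on_def)
  then show "\<forall>\<^sub>F y in at x within X. h (f y) (g y) = h (f x) (g x)"
    by eventually_elim simp
qed

lemma locally_constant_apply:
  assumes "\<And>m. locally_constant_on X (\<lambda>x. f x m)" "locally_constant_on X n"
  shows "locally_constant_on X (\<lambda>x. f x (n x))"
  unfolding locally_constant_on_def
proof
  fix x assume "x \<in> X"
  with assms have "\<forall>\<^sub>F y in at x within X. f y (n x) = f x (n x)" "\<forall>\<^sub>F y in at x within X. n y = n x"
    by (auto simp: locally_constant_on_def)
  then show "\<forall>\<^sub>F y in at x within X. f y (n y) = f x (n x)"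
    by eventually_elim simp
qed

lemma locally_constant_map_list:
  assumes "\<And>i. locally_constant_on X (\<lambda>x. f x i)"
  shows "locally_constant_on X (\<lambda>x. map (f x) xs)"
proof (induction xs)
  case Nil show ?case by (simp add: locally_constant_const)
next
  case (Cons a xs)
  show ?case using locally_constant_map2[OF assms[of a] Cons.IH, of "(#)"] by simp
qed

lemma locally_constant_all_less:
  fixes P :: "'a::topological_space \<Rightarrow> nat \<Rightarrow> bool"
  assumes "\<And>i. locally_constant_on X (\<lambda>x. P x i)"
  shows "locally_constant_on X (\<lambda>x. \<forall>i<n. P x i)"
  using locally_constant_map[OF locally_constant_map_list[of X P "[0..<n]", OF assms], of "\<lambda>bs. \<forall>b\<in>set bs. b"]
  by (simp add: Ball_image_comp atLeast0LessThan lessThan_def)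

lemmas locally_constant_connectives =
  locally_constant_map[where h = Not] locally_constant_map2[where h = "(\<and>)"] locally_constant_map2[where h = "(\<or>)"]
  locally_constant_map2[where h = "(\<longrightarrow>)"] locally_constant_all_less locally_constant_const

lemma locally_constant_LEAST:
  fixes P :: "'a::topological_space \<Rightarrow> nat \<Rightarrow> bool"
  assumes lc: "\<And>n. locally_constant_on X (\<lambda>x. P x n)" and ex: "\<And>x. x \<in> X \<Longrightarrow> \<exists>n. P x n"
  shows "locally_constant_on X (\<lambda>x. LEAST n. P x n)"
  unfolding locally_constant_on_def
proof
  fix x assume x: "x \<in> X"
  let ?n = "LEAST n. P x n"
  have "\<forall>\<^sub>F y in at x within X. \<forall>i\<in>{..?n}. P y i = P x i"
    using lc x by (intro eventually_ball_finite) (auto simp: locally_constant_on_def)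
  then show "\<forall>\<^sub>F y in at x within X. (LEAST n. P y n) = ?n"
  proof eventually_elim
    case (elim y)
    have "P x ?n" using ex[OF x] by (rule LeastI_ex)
    with elim have "P y ?n" by simp
    then show ?case
    proof (rule Least_equality)
      fix i assume "P y i"
      show "?n \<le> i"
      proof (rule ccontr)
        assume "\<not> ?n \<le> i"
        then have "P x i" "i < ?n" using elim \<open>P y i\<close> by auto
        then show False using not_less_Least by blast
      qed
    qed
  qed
qed

lemma locally_constant_compose:
  assumes "locally_constant_on Y f" "continuous_on X g" "g ` X \<subseteq> Y"
  shows "locally_constant_on X (\<lambda>x. f (g x))"
  unfolding locally_constant_on_def
proof
  fix x assume x: "x \<in> X"
  then have "\<forall>\<^sub>F z in nhds (g x). z \<noteq> g x \<longrightarrow> z \<in> Y \<longrightarrow> f z = f (g x)"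
    using assms by (auto simp: locally_constant_on_def eventually_at_filter)
  then have "\<forall>\<^sub>F z in nhds (g x). z \<in> Y \<longrightarrow> f z = f (g x)"
    by eventually_elim auto
  moreover have "filterlim g (nhds (g x)) (at x within X)"
    using assms(2) x by (simp add: continuous_on_def)
  ultimately have "\<forall>\<^sub>F y in at x within X. g y \<in> Y \<longrightarrow> f (g y) = f (g x)"
    by (rule eventually_compose_filterlim)
  moreover have "\<forall>\<^sub>F y in at x within X. y \<in> X"
    by (simp add: eventually_at_filter)
  ultimately show "\<forall>\<^sub>F y in at x within X. f (g y) = f (g x)"
    by eventually_elim (use assms(3) in auto)
qed

lemma continuous_imp_locally_constant:
  fixes f :: "'a::topological_space \<Rightarrow> 'b::discrete_topology"
  assumes "continuous_on X f"
  shows "locally_constant_on X f"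
  using assms by (simp add: locally_constant_on_def continuous_on_def tendsto_discrete)

lemma locally_constant_imp_continuous:
  assumes "locally_constant_on X f"
  shows "continuous_on X f"
  unfolding continuous_on_def
proof
  fix x assume "x \<in> X"
  with assms have "\<forall>\<^sub>F y in at x within X. f y = f x"
    by (auto simp: locally_constant_on_def)
  then have "\<forall>\<^sub>F y in at x within X. f x = f y"
    by eventually_elim simp
  then show "(f \<longlongrightarrow> f x) (at x within X)"
    using tendsto_cong tendsto_const by fastforce
qed

lemma locally_constant_coord:
  fixes f :: "'a::topological_space \<Rightarrow> 'i \<Rightarrow> 'b::discrete_topology"
  shows "continuous_on X f \<Longrightarrow> locally_constant_on X (\<lambda>x. f x i)"
  by (rule continuous_imp_locally_constant) (rule continuous_on_product_then_coordinatewise)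

lemma locally_constant_open: assumes "locally_constant P" shows "open {x. P x}"
proof (subst open_subopen, intro ballI)
  fix x assume "x \<in> {x. P x}"
  then have "\<forall>\<^sub>F y in nhds x. P y"
    using assms by (auto simp: locally_constant_on_def eventually_at_filter elim: eventually_mono)
  then show "\<exists>T. open T \<and> x \<in> T \<and> T \<subseteq> {x. P x}"
    by (auto simp: eventually_nhds)
qed

lemma locally_constant_closed: "locally_constant P \<Longrightarrow> closed {x. P x}"
  using locally_constant_open[OF locally_constant_map[of UNIV P Not]] by (simp add: closed_def Collect_neg_eq)

lemma closed_all_locally_constant: "(\<And>n. locally_constant (\<lambda>x. P x n)) \<Longrightarrow> closed {x. \<forall>n. P x n}"
  using closed_INT[of UNIV "\<lambda>n. {x. P x n}"] locally_constant_closed[of "\<lambda>x. P x n" for n]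
  by (simp add: Collect_all_eq)

section \<open>Stems and basic open sets\<close>

definition stem :: "(nat \<Rightarrow> 'a) \<Rightarrow> nat \<Rightarrow> 'a list" where
  "stem x n = map x [0..<n]"

definition cyl :: "nat list \<Rightarrow> baire set" where
  "cyl s = {x. stem x (length s) = s}"

text \<open>A basis of the square, enumerated through the countability of the pairs of
stems, so that a point of Baire space can code data on all basic sets.\<close>

definition box :: "nat \<Rightarrow> (baire \<times> baire) set" where
  "box n = (case from_nat n of (a, b) \<Rightarrow> cyl a \<times> cyl b)"

lemma length_stem [simp]: "length (stem x n) = n" by (simp add: stem_def)

lemma stem_0 [simp]: "stem x 0 = []" by (simp add: stem_def)

lemma stem_Suc: "stem x (Suc n) = stem x n @ [x n]" by (simp add: stem_def)

lemma nth_stem [simp]: "i < n \<Longrightarrow> stem x n ! i = x i" by (simp add: stem_def)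

lemma take_stem [simp]: "take k (stem x n) = stem x (min k n)"
  by (simp add: stem_def take_map min_def)

lemma mem_cyl_iff: "x \<in> cyl s \<longleftrightarrow> (\<forall>i<length s. x i = s ! i)"
  by (auto simp: cyl_def list_eq_iff_nth_eq)

lemma stem_in_cyl [simp]: "x \<in> cyl (stem x n)" by (simp add: cyl_def)

lemma locally_constant_stem: "continuous_on X f \<Longrightarrow> locally_constant_on X (\<lambda>x. stem (f x :: baire) n)"
  unfolding stem_def by (intro locally_constant_map_list locally_constant_coord)

lemma locally_constant_cyl: "continuous_on X f \<Longrightarrow> locally_constant_on X (\<lambda>x. f x \<in> cyl s)"
  unfolding cyl_def using locally_constant_map[OF locally_constant_stem, of X f "\<lambda>t. t = s"] by simp

lemma locally_constant_box: "continuous_on X f \<Longrightarrow> locally_constant_on X (\<lambda>x. f x \<in> box n)"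
  unfolding box_def mem_Times_iff case_prod_unfold
  by (intro locally_constant_connectives locally_constant_cyl continuous_on_fst continuous_on_snd)

lemma stem_nhds:
  assumes "open U" "x \<in> U"
  shows "\<exists>n. cyl (stem x n) \<subseteq> U"
proof -
  have "openin (product_topology (\<lambda>i. euclidean) UNIV) U"
    using assms(1) by (simp add: open_fun_def)
  from product_topology_open_contains_basis[OF this assms(2)]
  obtain X where X: "x \<in> (\<Pi>\<^sub>E i\<in>UNIV. X i)" "finite {i. X i \<noteq> UNIV}" "(\<Pi>\<^sub>E i\<in>UNIV. X i) \<subseteq> U"
    by (auto simp: PiE_def)
  obtain n where n: "\<And>i. X i \<noteq> UNIV \<Longrightarrow> i < n"
    using X(2) finite_nat_set_iff_bounded by auto
  have "cyl (stem x n) \<subseteq> (\<Pi>\<^sub>E i\<in>UNIV. X i)"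
  proof
    fix y assume y: "y \<in> cyl (stem x n)"
    have "y i \<in> X i" for i
    proof (cases "i < n")
      case True then show ?thesis using y X(1) by (auto simp: mem_cyl_iff)
    next
      case False then show ?thesis using n by blast
    qed
    then show "y \<in> (\<Pi>\<^sub>E i\<in>UNIV. X i)" by auto
  qed
  then show ?thesis using X(3) by blast
qed

lemma cyl_stem_mono: "m \<le> n \<Longrightarrow> cyl (stem x n) \<subseteq> cyl (stem x m)"
  by (auto simp: mem_cyl_iff)

lemma stem_nhds_prod:
  assumes "open U" "(x, y) \<in> U"
  shows "\<exists>n. cyl (stem x n) \<times> cyl (stem y n) \<subseteq> U"
proof -
  obtain A B where AB: "open A" "open B" "x \<in> A" "y \<in> B" "A \<times> B \<subseteq> U"
    using assms by (auto elim: open_prod_elim)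
  then obtain m n where "cyl (stem x m) \<subseteq> A" "cyl (stem y n) \<subseteq> B"
    using stem_nhds by metis
  then have "cyl (stem x (max m n)) \<times> cyl (stem y (max m n)) \<subseteq> A \<times> B"
    using cyl_stem_mono[of m "max m n" x] cyl_stem_mono[of n "max m n" y] by auto
  then show ?thesis using AB by blast
qed

section \<open>Closure properties of analytic sets\<close>

text \<open>A point of Baire space as a sequence of points, inverted by \<open>of_rows\<close>.\<close>

definition row :: "baire \<Rightarrow> nat \<Rightarrow> baire" where
  "row x i = (\<lambda>n. x (to_nat (i, n)))"

definition of_rows :: "(nat \<Rightarrow> baire) \<Rightarrow> baire" where
  "of_rows r = (\<lambda>k. case from_nat k of (i, n) \<Rightarrow> r i n)"

lemma row_of_rows [simp]: "row (of_rows r) i = r i"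
  by (simp add: row_def of_rows_def)

lemma continuous_on_row [continuous_intros]: "continuous_on X f \<Longrightarrow> continuous_on X (\<lambda>x. row (f x) i)"
  unfolding row_def
  by (rule continuous_on_coordinatewise_then_product) (rule continuous_on_product_then_coordinatewise)

lemma analyticI:
  fixes F :: "'a::topological_space \<Rightarrow> baire \<Rightarrow> bool"
  assumes "closed {p. F (fst p) (snd p)}" "\<And>x. P x \<longleftrightarrow> (\<exists>z. F x z)"
  shows "analytic {x. P x}"
proof -
  have "{x. P x} = fst ` {p. F (fst p) (snd p)}"
    unfolding assms(2) by (auto simp: image_iff)
  then show ?thesis unfolding analytic_def using assms(1) by blast
qed

lemma analyticE:
  assumes "analytic {x. P x}"
  obtains F :: "'a::topological_space \<Rightarrow> baire \<Rightarrow> bool"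
  where "closed {p. F (fst p) (snd p)}" "\<And>x. P x \<longleftrightarrow> (\<exists>z. F x z)"
proof -
  from assms obtain F :: "('a \<times> baire) set" where F: "closed F" "{x. P x} = fst ` F"
    unfolding analytic_def by blast
  have "P x \<longleftrightarrow> (\<exists>z. (x, z) \<in> F)" for x using F(2) by force
  then show ?thesis using that[of "\<lambda>x z. (x, z) \<in> F"] F(1) by simp
qed

lemma closed_rel_compose:
  assumes "closed {p. F (fst p) (snd p)}" "continuous_on UNIV f" "continuous_on UNIV g"
  shows "closed {p. F (f p) (g p)}"
proof -
  have "closed ((\<lambda>p. (f p, g p)) -` {p. F (fst p) (snd p)})"
    using assms by (intro closed_vimage continuous_on_Pair) auto
  then show ?thesis by (simp add: vimage_def)
qed

lemma analytic_closed: "closed {x. P x} \<Longrightarrow> analytic {x. P x}"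
  by (rule analyticI[of "\<lambda>x z. P x"]) (use closed_vimage_fst[of "{x. P x}"] in \<open>simp_all add: vimage_def\<close>)

lemma analytic_locally_constant: "locally_constant P \<Longrightarrow> analytic {x. P x}"
  by (intro analytic_closed locally_constant_closed)

lemma analytic_compose:
  assumes "analytic {x. P x}" "continuous_on UNIV f"
  shows "analytic {x. P (f x)}"
proof -
  from assms(1) obtain F :: "_ \<Rightarrow> baire \<Rightarrow> bool"
    where F: "closed {p. F (fst p) (snd p)}" "\<And>x. P x \<longleftrightarrow> (\<exists>z. F x z)"
    by (rule analyticE) blast
  have "closed {p. F (f (fst p)) (snd p)}"
    by (intro closed_rel_compose[OF F(1)] continuous_on_compose2[OF assms(2)] continuous_intros) auto
  then show ?thesis
    by (rule analyticI) (rule F(2))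
qed

lemma analytic_ex_baire:
  assumes "analytic {p. P (fst p) (snd p)}"
  shows "analytic {x. \<exists>w :: baire. P x w}"
proof -
  from assms obtain F :: "_ \<Rightarrow> baire \<Rightarrow> bool" where F: "closed {p. F (fst p) (snd p)}"
    "\<And>p. P (fst p) (snd p) \<longleftrightarrow> (\<exists>z. F p z)"
    by (rule analyticE) blast
  have "closed {q. F (fst q, row (snd q) 0) (row (snd q) 1)}"
    by (intro closed_rel_compose[OF F(1)] continuous_intros)
  moreover have "(\<exists>w. P x w) \<longleftrightarrow> (\<exists>u. F (x, row u 0) (row u 1))" for x
  proof
    assume "\<exists>w. P x w"
    then obtain w z where "F (x, w) z" using F(2)[of "(x, w)" for w] by auto
    then show "\<exists>u. F (x, row u 0) (row u 1)"
      by (intro exI[of _ "of_rows (\<lambda>i. if i = 0 then w else z)"]) simp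
  next
    assume "\<exists>u. F (x, row u 0) (row u 1)"
    then show "\<exists>w. P x w" using F(2)[of "(x, w)" for w] by auto
  qed
  ultimately show ?thesis
    by (rule analyticI[of "\<lambda>x u. F (x, row u 0) (row u 1)"])
qed

lemma analytic_all:
  fixes P :: "'a::topological_space \<Rightarrow> nat \<Rightarrow> bool"
  assumes "\<And>n. analytic {x. P x n}"
  shows "analytic {x. \<forall>n. P x n}"
proof -
  have "\<exists>F. closed {p. F (fst p) (snd p :: baire)} \<and> (\<forall>x. P x n \<longleftrightarrow> (\<exists>z. F x z))" for n
    by (rule analyticE[OF assms[of n]]) blast
  then obtain F :: "nat \<Rightarrow> 'a \<Rightarrow> baire \<Rightarrow> bool"
    where F: "\<And>n. closed {p. F n (fst p) (snd p)}" "\<And>n x. P x n \<longleftrightarrow> (\<exists>z. F n x z)"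
    by metis
  have "closed {p. F n (fst p) (row (snd p) n)}" for n
    by (intro closed_rel_compose[OF F(1)] continuous_intros)
  then have "closed {p. \<forall>n. F n (fst p) (row (snd p) n)}"
    using closed_INT[of UNIV "\<lambda>n. {p. F n (fst p) (row (snd p) n)}"] by (simp add: Collect_all_eq)
  moreover have "(\<forall>n. P x n) \<longleftrightarrow> (\<exists>u. \<forall>n. F n x (row u n))" for x
  proof
    assume "\<forall>n. P x n"
    then obtain r where "\<And>n. F n x (r n)" using F(2) by metis
    then show "\<exists>u. \<forall>n. F n x (row u n)" by (intro exI[of _ "of_rows r"]) simp
  next
    assume "\<exists>u. \<forall>n. F n x (row u n)"
    then show "\<forall>n. P x n" using F(2) by blast
  qed
  ultimately show ?thesis
    by (rule analyticI[of "\<lambda>x u. \<forall>n. F n x (row u n)"])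
qed

lemma analytic_ex:
  fixes P :: "'a::topological_space \<Rightarrow> nat \<Rightarrow> bool"
  assumes "\<And>n. analytic {x. P x n}"
  shows "analytic {x. \<exists>n. P x n}"
proof -
  have "\<exists>F. closed {p. F (fst p) (snd p :: baire)} \<and> (\<forall>x. P x n \<longleftrightarrow> (\<exists>z. F x z))" for n
    by (rule analyticE[OF assms[of n]]) blast
  then obtain F :: "nat \<Rightarrow> 'a \<Rightarrow> baire \<Rightarrow> bool"
    where F: "\<And>n. closed {p. F n (fst p) (snd p)}" "\<And>n x. P x n \<longleftrightarrow> (\<exists>z. F n x z)"
    by metis
  have "closed {p. row (snd p) 0 0 = n \<longrightarrow> F n (fst p) (row (snd p) 1)}" for n
  proof -
    have "locally_constant (\<lambda>p :: 'a \<times> baire. row (snd p) 0 0)"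
      by (intro locally_constant_coord continuous_intros)
    then have "closed {p :: 'a \<times> baire. row (snd p) 0 0 \<noteq> n}"
      by (intro locally_constant_closed) (rule locally_constant_map)
    moreover have "closed {p. F n (fst p) (row (snd p) 1)}"
      by (intro closed_rel_compose[OF F(1)] continuous_intros)
    ultimately show ?thesis unfolding imp_conv_disj by (rule closed_Collect_disj)
  qed
  then have "closed (\<Inter>n. {p. row (snd p) 0 0 = n \<longrightarrow> F n (fst p) (row (snd p) 1)})"
    by (intro closed_INT ballI)
  then have "closed {p. F (row (snd p) 0 0) (fst p) (row (snd p) 1)}"
    by (rule back_subst[of closed]) auto
  moreover have "(\<exists>n. P x n) \<longleftrightarrow> (\<exists>u. F (row u 0 0) x (row u 1))" for x
  proof
    assume "\<exists>n. P x n"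
    then obtain n z where "F n x z" using F(2) by blast
    then have "F (row (of_rows (\<lambda>i. if i = 0 then \<lambda>_. n else z)) 0 0) x
        (row (of_rows (\<lambda>i. if i = 0 then \<lambda>_. n else z)) 1)" by simp
    then show "\<exists>u. F (row u 0 0) x (row u 1)" by (rule exI[of "\<lambda>u. F (row u 0 0) x (row u 1)"])
  next
    assume "\<exists>u. F (row u 0 0) x (row u 1)"
    then show "\<exists>n. P x n" using F(2) by blast
  qed
  ultimately show ?thesis
    by (rule analyticI[of "\<lambda>x u. F (row u 0 0) x (row u 1)"])
qed

lemma analytic_conj:
  assumes "analytic {x. P x}" "analytic {x. Q x}"
  shows "analytic {x. P x \<and> Q x}"
proof -
  have "analytic {x. if n = 0 then P x else Q x}" for n :: nat
    using assms by (cases "n = 0") simp_all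
  then have "analytic {x. \<forall>n::nat. if n = 0 then P x else Q x}"
    by (rule analytic_all)
  moreover have "(\<forall>n::nat. if n = 0 then P x else Q x) \<longleftrightarrow> P x \<and> Q x" for x
    by (metis zero_neq_one)
  ultimately show ?thesis by simp
qed

lemma analytic_disj:
  assumes "analytic {x. P x}" "analytic {x. Q x}"
  shows "analytic {x. P x \<or> Q x}"
proof -
  have "analytic {x. if n = 0 then P x else Q x}" for n :: nat
    using assms by (cases "n = 0") simp_all
  then have "analytic {x. \<exists>n::nat. if n = 0 then P x else Q x}"
    by (rule analytic_ex)
  moreover have "(\<exists>n::nat. if n = 0 then P x else Q x) \<longleftrightarrow> P x \<or> Q x" for x
    by (metis zero_neq_one)
  ultimately show ?thesis by simp
qed

lemma closed_mem_stem:
  assumes "closed S" "\<And>n. \<exists>v\<in>S. v \<in> cyl (stem y n)"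
  shows "y \<in> S"
proof (rule ccontr)
  assume "y \<notin> S"
  then obtain n where "cyl (stem y n) \<subseteq> - S"
    using stem_nhds[of "- S" y] assms(1) by (auto simp: open_Compl)
  then show False using assms(2)[of n] by auto
qed

section \<open>Reductions and codes of continuous functions\<close>

text \<open>A choice function can take any prescribed value at the one point \<open>h x\<close>, so a reduction sends
the whole section of \<open>B\<close> at \<open>h x\<close> into the section of \<open>A\<close> at \<open>x\<close>, and it forces
that section of \<open>B\<close> to be nonempty.\<close>

lemma reducible2E:
  assumes "A \<le>\<^sub>2 B"
  obtains h \<kappa> where "continuous_on UNIV h"
    "continuous_on {(x, w). sect A x \<noteq> {} \<and> w \<in> sect B (h x)} \<kappa>"
    "\<And>x. sect A x \<noteq> {} \<Longrightarrow> sect B (h x) \<noteq> {}"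
    "\<And>x w. sect A x \<noteq> {} \<Longrightarrow> w \<in> sect B (h x) \<Longrightarrow> \<kappa> (x, w) \<in> sect A x"
proof -
  from assms obtain h k where h: "continuous_on UNIV h" and k: "partial_continuous k"
    and red: "\<And>g. is_choice B g \<Longrightarrow> is_choice A (\<lambda>x. Option.bind (g (h x)) (\<lambda>w. k (x, w)))"
    unfolding reducible2_def by blast
  define g0 where "g0 z = (if sect B z = {} then None else Some (SOME w. w \<in> sect B z))" for z
  have some_in: "(SOME w. w \<in> sect B z) \<in> sect B z" if "sect B z \<noteq> {}" for z
    using that by (meson ex_in_conv someI_ex)
  have g0: "is_choice B g0"
    unfolding is_choice_def g0_def using some_in by simp
  have *: "\<exists>y. k (x, w) = Some y \<and> y \<in> sect A x" if "sect A x \<noteq> {}" "w \<in> sect B (h x)" for x w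
  proof -
    have "is_choice B (g0(h x := Some w))"
      using g0 that(2) unfolding is_choice_def by simp
    from red[OF this] that(1) show ?thesis
      unfolding is_choice_def by (auto dest: spec[of _ x])
  qed
  have "sect B (h x) \<noteq> {}" if "sect A x \<noteq> {}" for x
  proof
    assume "sect B (h x) = {}"
    then show False using red[OF g0] that unfolding is_choice_def g0_def by (auto dest!: spec[of _ x])
  qed
  moreover have "continuous_on {(x, w). sect A x \<noteq> {} \<and> w \<in> sect B (h x)} (\<lambda>v. the (k v))"
    using k unfolding partial_continuous_def by (rule continuous_on_subset) (use * in blast)
  moreover have "the (k (x, w)) \<in> sect A x" if "sect A x \<noteq> {}" "w \<in> sect B (h x)" for x w
    using *[OF that] by force
  ultimately show ?thesis using that[OF h, of "\<lambda>v. the (k v)"] by blast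
qed

text \<open>The point \<open>e\<close> codes a partial function to \<open>\<nat>\<close>: an entry \<open>Suc m\<close> at \<open>n\<close> claims the value \<open>m\<close> on
\<open>box n\<close>. Reading only the first claim that concerns \<open>v\<close> makes the value unique for every \<open>e\<close>, also when
the claims of \<open>e\<close> are inconsistent.\<close>

definition decodes :: "baire \<Rightarrow> baire \<times> baire \<Rightarrow> nat \<Rightarrow> bool" where
  "decodes e v m \<longleftrightarrow> (\<exists>n. v \<in> box n \<and> e n = Suc m \<and> (\<forall>i<n. v \<in> box i \<longrightarrow> e i = 0))"

lemma decodes_unique: "decodes e v m \<Longrightarrow> decodes e v m' \<Longrightarrow> m = m'"
  unfolding decodes_def by (metis linorder_neqE_nat nat.distinct(1) nat.inject)

lemma locally_constant_decodes_at:
  assumes "continuous_on UNIV e" "continuous_on UNIV v" "locally_constant m"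
  shows "locally_constant (\<lambda>x. v x \<in> box n \<and> (e x :: baire) n = Suc (m x) \<and> (\<forall>i<n. v x \<in> box i \<longrightarrow> e x i = 0))"
  by (intro locally_constant_connectives locally_constant_box assms
      locally_constant_map2[where h = "(=)"] locally_constant_coord locally_constant_map[OF assms(3)])

lemma analytic_decodes:
  assumes "continuous_on UNIV e" "continuous_on UNIV v" "locally_constant m"
  shows "analytic {x. decodes (e x) (v x) (m x)}"
  unfolding decodes_def by (intro analytic_ex analytic_locally_constant locally_constant_decodes_at assms)

lemma closed_not_decodes:
  assumes "continuous_on UNIV e" "continuous_on UNIV v" "locally_constant m"
  shows "closed {x. \<not> decodes (e x) (v x) (m x)}"
  unfolding decodes_def not_ex
  by (rule closed_all_locally_constant) (intro locally_constant_connectives(1) locally_constant_decodes_at assms)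

text \<open>The code claims every value that is constant on \<open>D \<inter> box n\<close> for a box that meets \<open>D\<close>. By continuity
this happens for all sufficiently small boxes around a point of \<open>D\<close>, whether or not the function extends
continuously beyond \<open>D\<close>.\<close>

lemma exists_code:
  fixes \<kappa> :: "baire \<times> baire \<Rightarrow> baire"
  assumes "continuous_on D \<kappa>"
  obtains E :: "nat \<Rightarrow> baire" where
    "\<And>i x w. (x, w) \<in> D \<Longrightarrow> \<exists>K. \<forall>k\<ge>K. E i (to_nat (stem x k, stem w k)) = Suc (\<kappa> (x, w) i)"
    "\<And>i v n m. v \<in> D \<Longrightarrow> v \<in> box n \<Longrightarrow> E i n = Suc m \<Longrightarrow> \<kappa> v i = m"
proof -
  let ?C = "\<lambda>i n m. (\<exists>v\<in>D \<inter> box n. \<kappa> v i = m) \<and> (\<forall>v\<in>D \<inter> box n. \<kappa> v i = m)"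
  define E where "E i n = (if \<exists>m. ?C i n m then Suc (THE m. ?C i n m) else 0)" for i n
  have E: "E i n = Suc m \<longleftrightarrow> ?C i n m" for i n m
  proof -
    have "(THE m. ?C i n m) = m" if "?C i n m" for m
      using that by (intro the_equality) auto
    then show ?thesis unfolding E_def by (smt (verit) nat.distinct(1) nat.inject)
  qed
  show ?thesis
  proof
    fix i x w assume xw: "(x, w) \<in> D"
    have "\<forall>\<^sub>F v in at (x, w) within D. \<kappa> v i = \<kappa> (x, w) i"
      using locally_constant_coord[OF assms, of i] xw by (auto simp: locally_constant_on_def)
    then obtain U where U: "open U" "(x, w) \<in> U" "\<And>v. v \<in> U \<Longrightarrow> v \<noteq> (x, w) \<Longrightarrow> v \<in> D \<Longrightarrow> \<kappa> v i = \<kappa> (x, w) i"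
      by (auto simp: eventually_at_topological)
    obtain K where K: "cyl (stem x K) \<times> cyl (stem w K) \<subseteq> U"
      using stem_nhds_prod[OF U(1,2)] by blast
    have "E i (to_nat (stem x k, stem w k)) = Suc (\<kappa> (x, w) i)" if "k \<ge> K" for k
    proof -
      have "box (to_nat (stem x k, stem w k)) = cyl (stem x k) \<times> cyl (stem w k)"
        by (simp add: box_def)
      then have "box (to_nat (stem x k, stem w k)) \<subseteq> U"
        using K cyl_stem_mono[OF that, of x] cyl_stem_mono[OF that, of w] by auto
      then have "\<kappa> v i = \<kappa> (x, w) i" if "v \<in> D \<inter> box (to_nat (stem x k, stem w k))" for v
        using U(3)[of v] that by (cases "v = (x, w)") auto
      moreover have "(x, w) \<in> D \<inter> box (to_nat (stem x k, stem w k))"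
        using xw by (simp add: box_def)
      ultimately show ?thesis unfolding E by blast
    qed
    then show "\<exists>K. \<forall>k\<ge>K. E i (to_nat (stem x k, stem w k)) = Suc (\<kappa> (x, w) i)" by blast
  next
    fix i v n m assume "v \<in> D" "v \<in> box n" "E i n = Suc m"
    then show "\<kappa> v i = m" using E by blast
  qed
qed

lemma mem_box_stem [simp]: "(x, w) \<in> box (to_nat (stem x k, stem w k))"
  by (simp add: box_def)

lemma decodes_code:
  fixes e :: baire
  assumes "\<exists>K. \<forall>k\<ge>K. e (to_nat (stem x k, stem w k)) = Suc c"
    and "\<And>n m. (x, w) \<in> box n \<Longrightarrow> e n = Suc m \<Longrightarrow> c = m"
  shows "decodes e (x, w) c"
proof -
  let ?P = "\<lambda>n. (x, w) \<in> box n \<and> e n \<noteq> 0"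
  obtain k where "e (to_nat (stem x k, stem w k)) = Suc c" using assms(1) by blast
  then have P: "?P (LEAST n. ?P n)"
    by (intro LeastI[of ?P "to_nat (stem x k, stem w k)"]) simp
  then obtain m where m: "e (LEAST n. ?P n) = Suc m" using not0_implies_Suc by blast
  then have "m = c" using P assms(2) by blast
  moreover have "\<forall>i < (LEAST n. ?P n). (x, w) \<in> box i \<longrightarrow> e i = 0"
    using not_less_Least[of _ ?P] by blast
  ultimately show ?thesis unfolding decodes_def using P m by blast
qed

lemma exists_decoding_code:
  fixes \<kappa> :: "baire \<times> baire \<Rightarrow> baire"
  assumes "continuous_on D \<kappa>"
  shows "\<exists>E :: nat \<Rightarrow> baire. \<forall>i. \<forall>v\<in>D. decodes (E i) v (\<kappa> v i)"
proof -
  obtain E :: "nat \<Rightarrow> baire" where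
    E: "\<And>i x w. (x, w) \<in> D \<Longrightarrow> \<exists>K. \<forall>k\<ge>K. E i (to_nat (stem x k, stem w k)) = Suc (\<kappa> (x, w) i)"
    "\<And>i v n m. v \<in> D \<Longrightarrow> v \<in> box n \<Longrightarrow> E i n = Suc m \<Longrightarrow> \<kappa> v i = m"
    using exists_code[OF assms] by blast
  have "decodes (E i) (x, w) (\<kappa> (x, w) i)" if "(x, w) \<in> D" for i x w
    by (rule decodes_code[OF E(1)[OF that] E(2)[OF that]])
  then show ?thesis by (metis surj_pair)
qed

section \<open>No total analytic set is above all those with homogeneous sections\<close>

text \<open>The set \<open>B\<close> reads \<open>x\<close> as a code of \<open>h\<close> (rows \<open>Suc i\<close>) and of the first entry of \<open>k\<close> (row \<open>0\<close>), and
it accepts \<open>y\<close> if \<open>y 0\<close> exceeds \<open>k(x, w)(0)\<close> for some \<open>w \<in> A(h(x))\<close>. Its sections restrict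
one coordinate only, so they are products. Undefined values are accepted, which keeps \<open>B\<close> total and is
still an analytic condition.\<close>

lemma homogeneous_set_not_below:
  fixes A :: "(baire \<times> baire) set"
  assumes tot: "total_set A" and an: "analytic A"
  shows "\<exists>B :: (baire \<times> baire) set. total_set B \<and> analytic B \<and> has_sections homogeneous B \<and> \<not> B \<le>\<^sub>2 A"
proof -
  define P where "P x n \<longleftrightarrow> (\<exists>i. \<forall>m. \<not> decodes (row x (Suc i)) (x, x) m) \<or>
    (\<exists>u w. (\<forall>i. decodes (row x (Suc i)) (x, x) (u i)) \<and> (u, w) \<in> A \<and>
       (\<forall>m. decodes (row x 0) (x, w) m \<longrightarrow> m < n))" for x n
  define B where "B = {(x, y :: baire). P x (y 0)}"
  have nonempty: "\<exists>n. P x n" for x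
  proof (cases "\<exists>i. \<forall>m. \<not> decodes (row x (Suc i)) (x, x) m")
    case True then show ?thesis by (simp add: P_def)
  next
    case False
    then obtain u where u: "\<And>i. decodes (row x (Suc i)) (x, x) (u i)" by metis
    \<comment> \<open>The totality of \<open>A\<close> provides a candidate even if \<open>x\<close> codes no reduction.\<close>
    obtain w where w: "(u, w) \<in> A" using tot by (auto simp: total_set_def)
    have "\<exists>n. \<forall>m. decodes (row x 0) (x, w) m \<longrightarrow> m < n"
      by (metis decodes_unique lessI)
    then show ?thesis unfolding P_def using u w by blast
  qed
  have sect_B: "sect B x = {y. P x (y 0)}" for x
    by (auto simp: B_def)
  have "total_set B"
    unfolding total_set_def sect_B
  proof
    fix x
    obtain n where "P x n" using nonempty by blast
    then have "(\<lambda>_. n) \<in> {y. P x (y 0)}" by simp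
    then show "{y. P x (y 0)} \<noteq> {}" by (metis empty_iff)
  qed
  moreover have "has_sections homogeneous B"
    unfolding has_sections_def homogeneous_iff_product sect_B
  proof
    fix x
    show "\<exists>S. (\<forall>n. S n \<noteq> {}) \<and> {y. P x (y 0)} = {f. \<forall>n. f n \<in> S n}"
      using nonempty by (intro exI[of _ "\<lambda>k. if k = 0 then {n. P x n} else UNIV"]) auto
  qed
  moreover have "analytic B"
  proof -
    have 1: "analytic {p :: baire \<times> baire. \<exists>i. \<forall>m. \<not> decodes (row (fst p) (Suc i)) (fst p, fst p) m}"
      by (intro analytic_ex analytic_all analytic_closed closed_not_decodes continuous_intros locally_constant_const)
    have 2: "analytic {r :: ((baire \<times> baire) \<times> baire) \<times> baire.
        \<forall>i. decodes (row (fst (fst (fst r))) (Suc i)) (fst (fst (fst r)), fst (fst (fst r))) (snd (fst r) i)}"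
      by (intro analytic_all analytic_decodes continuous_intros locally_constant_coord)
    have 3: "analytic {r :: ((baire \<times> baire) \<times> baire) \<times> baire. (snd (fst r), snd r) \<in> A}"
      using analytic_compose[of "\<lambda>v. v \<in> A" "\<lambda>r. (snd (fst r), snd r)"] an
      by (simp add: continuous_intros)
    have 4: "analytic {r :: ((baire \<times> baire) \<times> baire) \<times> baire.
       \<forall>m. decodes (row (fst (fst (fst r))) 0) (fst (fst (fst r)), snd r) m \<longrightarrow> m < snd (fst (fst r)) 0}"
      unfolding imp_conv_disj
      by (intro analytic_all analytic_disj analytic_closed[OF closed_not_decodes] continuous_intros locally_constant_const
          analytic_locally_constant locally_constant_map[OF locally_constant_coord])
    have "analytic {p :: baire \<times> baire. P (fst p) (snd p 0)}"
      unfolding P_def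
      by (intro analytic_disj[OF 1] analytic_ex_baire analytic_conj 2 3 4)
    then show ?thesis by (simp add: B_def case_prod_unfold)
  qed
  moreover have "\<not> B \<le>\<^sub>2 A"
  proof
    assume "B \<le>\<^sub>2 A"
    then obtain h \<kappa> where h: "continuous_on UNIV h"
      and \<kappa>: "continuous_on {(x, w). sect B x \<noteq> {} \<and> w \<in> sect A (h x)} \<kappa>"
      and red: "\<And>x w. sect B x \<noteq> {} \<Longrightarrow> w \<in> sect A (h x) \<Longrightarrow> \<kappa> (x, w) \<in> sect B x"
      by (rule reducible2E) blast
    have Bne: "sect B x \<noteq> {}" for x using \<open>total_set B\<close> by (simp add: total_set_def)
    obtain E where E: "\<And>i x w. w \<in> sect A (h x) \<Longrightarrow> decodes (E i) (x, w) (\<kappa> (x, w) i)"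
      using exists_decoding_code[OF \<kappa>] Bne by auto
    have "continuous_on UNIV (\<lambda>v :: baire \<times> baire. h (fst v))"
      by (intro continuous_on_compose2[OF h] continuous_intros) auto
    from exists_decoding_code[OF this]
    obtain G where G: "\<And>i x w. decodes (G i) (x, w) (h x i)" by auto
    define x where "x = of_rows (\<lambda>i. case i of 0 \<Rightarrow> E 0 | Suc j \<Rightarrow> G j)"
    have x: "row x 0 = E 0" "\<And>i. row x (Suc i) = G i" by (simp_all add: x_def)
    obtain w0 where "w0 \<in> sect A (h x)" using tot unfolding total_set_def by blast
    then obtain w where w: "w \<in> sect A (h x)" "\<And>w'. w' \<in> sect A (h x) \<Longrightarrow> \<kappa> (x, w) 0 \<le> \<kappa> (x, w') 0"
      using ex_has_least_nat[of "\<lambda>w. w \<in> sect A (h x)" w0 "\<lambda>w. \<kappa> (x, w) 0"] by blast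
    \<comment> \<open>Acceptance would need some \<open>w\<close> in the section with a strictly smaller first entry.\<close>
    have "P x (\<kappa> (x, w) 0)" using red[OF Bne w(1)] by (simp add: sect_B)
    moreover have "\<not> (\<exists>i. \<forall>m. \<not> decodes (G i) (x, x) m)" using G by blast
    ultimately obtain u w' where u: "\<And>i. decodes (G i) (x, x) (u i)" "(u, w') \<in> A"
      "\<And>m. decodes (E 0) (x, w') m \<Longrightarrow> m < \<kappa> (x, w) 0"
      unfolding P_def x by blast
    have "u = h x" using u(1) G decodes_unique by blast
    then have "w' \<in> sect A (h x)" using u(2) by simp
    then show False using w(2) u(3) E by (meson not_le)
  qed
  ultimately show ?thesis by blast
qed

section \<open>A set with dense sections and no continuous choice\<close>

text \<open>The second side has to extend \<open>s\<close>, and not merely to be compatible with it, so that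
successive stems are nested.\<close>

definition decides_next :: "(nat \<Rightarrow> baire) \<Rightarrow> nat \<Rightarrow> baire \<Rightarrow> nat list \<Rightarrow> nat \<Rightarrow> bool" where
  "decides_next E i x s n \<longleftrightarrow> (case from_nat n of (a, b) \<Rightarrow> x \<in> cyl a \<and> take (length s) b = s \<and> E i n \<noteq> 0)"

text \<open>The second sides of successive first claims on entries \<open>0\<close>, \<open>1\<close>, \<open>2\<close> and so on: a growing stem
that decides the values of the coded function at \<open>x\<close> and depends on \<open>x\<close> in a locally constant way.\<close>

primrec generic_stem :: "(nat \<Rightarrow> baire) \<Rightarrow> baire \<Rightarrow> nat \<Rightarrow> nat list" where
  "generic_stem E x 0 = []"
| "generic_stem E x (Suc i) =
     snd (from_nat (LEAST n. decides_next E i x (generic_stem E x i) n) :: nat list \<times> nat list)"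

text \<open>The limit \<open>w\<close> of the stems need not satisfy \<open>(x, w) \<in> D\<close>, but by density every one of these stems extends to a
point of the section of \<open>D\<close>, and there \<open>\<kappa>\<close> takes the decided values. Hence \<open>\<phi> x\<close> lies in the closure of the
values of \<open>\<kappa>\<close> over \<open>x\<close>.\<close>

lemma dense_selection:
  fixes \<kappa> :: "baire \<times> baire \<Rightarrow> baire"
  assumes cont: "continuous_on D \<kappa>" and dense: "\<And>x s. \<exists>w\<in>cyl s. (x, w) \<in> D"
  shows "\<exists>\<phi>. continuous_on UNIV \<phi> \<and> (\<forall>x n. \<exists>w. (x, w) \<in> D \<and> \<kappa> (x, w) \<in> cyl (stem (\<phi> x) n))"
proof -
  obtain E where E1: "\<And>i x w. (x, w) \<in> D \<Longrightarrow> \<exists>K. \<forall>k\<ge>K. E i (to_nat (stem x k, stem w k)) = Suc (\<kappa> (x, w) i)"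
    and E2: "\<And>i v n m. v \<in> D \<Longrightarrow> v \<in> box n \<Longrightarrow> E i n = Suc m \<Longrightarrow> \<kappa> v i = m"
    using exists_code[OF cont] by blast
  have ex: "\<exists>n. decides_next E i x s n" for i x s
  proof -
    obtain w where w: "w \<in> cyl s" "(x, w) \<in> D" using dense by blast
    then obtain K where K: "\<And>k. k \<ge> K \<Longrightarrow> E i (to_nat (stem x k, stem w k)) = Suc (\<kappa> (x, w) i)"
      using E1 by blast
    let ?k = "max K (length s)"
    have "decides_next E i x s (to_nat (stem x ?k, stem w ?k))"
      using K[of ?k] w(1) by (simp add: decides_next_def cyl_def min_def)
    then show ?thesis by blast
  qed
  let ?n = "\<lambda>x i. LEAST n. decides_next E i x (generic_stem E x i) n"
  have locally_constant_decides_next: "locally_constant (\<lambda>x. decides_next E i x (s x) n)" if "locally_constant s" for i n s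
  proof -
    have "locally_constant (\<lambda>x. decides_next E i x t n)" for t
      unfolding decides_next_def case_prod_unfold
  by (intro locally_constant_connectives locally_constant_cyl continuous_intros)
    then show ?thesis using that by (rule locally_constant_apply)
  qed
  have locally_constant_generic_stem: "locally_constant (\<lambda>x. generic_stem E x i)" for i
  proof (induction i)
    case 0 show ?case by (simp add: locally_constant_const)
  next
    case (Suc i)
    show ?case
      unfolding generic_stem.simps by (rule locally_constant_map) (intro locally_constant_LEAST locally_constant_decides_next Suc.IH ex)
  qed
  define \<phi> where "\<phi> x i = E i (?n x i) - 1" for x i
  have "locally_constant (\<lambda>x. ?n x i)" for i
    by (intro locally_constant_LEAST locally_constant_decides_next locally_constant_generic_stem ex)
  from locally_constant_map[OF this] have "locally_constant (\<lambda>x. \<phi> x i)" for i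
    unfolding \<phi>_def .
  then have "continuous_on UNIV \<phi>"
    by (intro continuous_on_coordinatewise_then_product locally_constant_imp_continuous)
  moreover have "\<exists>w. (x, w) \<in> D \<and> \<kappa> (x, w) \<in> cyl (stem (\<phi> x) n)" for x n
  proof -
    \<comment> \<open>The stems are nested, so one point of \<open>D\<close> above the longest stem realizes all values decided so far.\<close>
    have fnd: "decides_next E i x (generic_stem E x i) (?n x i)" for i
      using ex by (rule LeastI_ex)
    have step: "take (length (generic_stem E x i)) (generic_stem E x (Suc i)) = generic_stem E x i" for i
      using fnd[of i] by (simp add: decides_next_def case_prod_unfold)
    have sub: "cyl (generic_stem E x j) \<subseteq> cyl (generic_stem E x i)" if "i \<le> j" for i j
    proof (rule lift_Suc_antimono_le[OF _ that])
      fix k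
      show "cyl (generic_stem E x (Suc k)) \<subseteq> cyl (generic_stem E x k)"
      proof
        fix w assume w: "w \<in> cyl (generic_stem E x (Suc k))"
        let ?s = "generic_stem E x k" and ?t = "generic_stem E x (Suc k)"
        have le: "length ?s \<le> length ?t"
          by (metis length_take min.cobounded1 step)
        have "stem w (length ?t) = ?t" using w by (simp add: cyl_def)
        then have "take (length ?s) (stem w (length ?t)) = ?s" using step[of k] by simp
        then show "w \<in> cyl ?s"
          using le by (simp add: cyl_def min_def)
      qed
    qed
    obtain w where w: "w \<in> cyl (generic_stem E x n)" "(x, w) \<in> D" using dense by blast
    have "\<kappa> (x, w) i = \<phi> x i" if "i < n" for i
    proof (rule E2[OF w(2)])
      have "w \<in> cyl (generic_stem E x (Suc i))" using sub[of "Suc i" n] w(1) that by auto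
      then show "(x, w) \<in> box (?n x i)"
        using fnd[of i] by (simp add: box_def decides_next_def case_prod_unfold)
      show "E i (?n x i) = Suc (\<phi> x i)"
        using fnd[of i] by (simp add: \<phi>_def decides_next_def case_prod_unfold)
    qed
    then show ?thesis using w(2) by (auto simp: mem_cyl_iff)
  qed
  ultimately show ?thesis by blast
qed

text \<open>Row \<open>m\<close> of \<open>x\<close> codes the \<open>m\<close>-th entry of a function, which is applied to \<open>x\<close>
itself. Differing infinitely often, rather than once, makes the sections invariant under finite changes
and hence dense.\<close>

lemma gdelta_set_not_equivalent_to_closed_sections:
  "\<exists>A :: (baire \<times> baire) set. total_set A \<and> f_sigma_delta A \<and> has_sections gdelta A \<and>
     (\<forall>B :: (baire \<times> baire) set. has_sections closed B \<longrightarrow> \<not> A \<equiv>\<^sub>2 B)"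
proof -
  let ?R = "\<lambda>x m q. \<not> decodes (row x m) (x, x) q"
  define A where "A = {(x, y :: baire). \<forall>n. \<exists>m\<ge>n. ?R x m (y m)}"
  have tail: "y' \<in> sect A x" if "y \<in> sect A x" "\<And>m. m \<ge> k \<Longrightarrow> y' m = y m" for x y y' k
  proof -
    have "\<exists>m\<ge>n. ?R x m (y' m)" for n
    proof -
      from that(1) have "\<exists>m\<ge>max n k. ?R x m (y m)" unfolding A_def by blast
      then obtain m where "m \<ge> max n k" "?R x m (y m)" by blast
      then show ?thesis using that(2)[of m] by (intro exI[of _ m]) simp
    qed
    then show ?thesis by (simp add: A_def)
  qed
  have tot: "sect A x \<noteq> {}" for x
  proof -
    have "\<exists>q. ?R x m q" for m
      using decodes_unique by (metis n_not_Suc_n)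
    then obtain y where "\<And>m. ?R x m (y m)" by metis
    then have "y \<in> sect A x" by (auto simp: A_def)
    then show ?thesis by blast
  qed
  have dense: "\<exists>y\<in>cyl s. y \<in> sect A x" for x s
  proof -
    obtain y where y: "y \<in> sect A x" using tot by blast
    let ?y = "\<lambda>i. if i < length s then s ! i else y i"
    have "?y \<in> sect A x" by (rule tail[OF y, of "length s"]) simp
    moreover have "?y \<in> cyl s" by (simp add: mem_cyl_iff)
    ultimately show ?thesis by (rule bexI)
  qed
  have "f_sigma_delta A"
    unfolding f_sigma_delta_def
  proof (intro exI conjI allI)
    fix n
    have "closed {p :: baire \<times> baire. ?R (fst p) m (snd p m)}" for m
      by (intro closed_not_decodes continuous_intros locally_constant_coord)
    then have "fsigma (\<Union>m. {p :: baire \<times> baire. ?R (fst p) (n + m) (snd p (n + m))})"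
      by (intro fsigma.intros)
    then show "fsigma {p :: baire \<times> baire. \<exists>m\<ge>n. ?R (fst p) m (snd p m)}"
      by (rule back_subst[of fsigma]) (auto simp: le_iff_add)
  next
    show "A = (\<Inter>n. {p. \<exists>m\<ge>n. ?R (fst p) m (snd p m)})"
      by (auto simp: A_def)
  qed
  moreover have "has_sections gdelta A"
    unfolding has_sections_def
  proof
    fix x
    have "open {y :: baire. \<exists>m\<ge>n. ?R x m (y m)}" for n
    proof -
      have "open {y :: baire. ?R x m (y m)}" for m
        by (intro locally_constant_open locally_constant_map[OF locally_constant_coord] continuous_intros)
      then have "open (\<Union>m\<in>{n..}. {y :: baire. ?R x m (y m)})" by blast
      then show ?thesis by (rule back_subst[of "open"]) auto
    qed
    then have "gdelta (\<Inter>n. {y :: baire. \<exists>m\<ge>n. ?R x m (y m)})"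
      by (intro gdelta.intros)
    then show "gdelta (sect A x)"
      by (rule back_subst[of gdelta]) (auto simp: A_def)
  qed
  moreover have "\<not> A \<equiv>\<^sub>2 B" if "has_sections closed B" for B :: "(baire \<times> baire) set"
  proof
    assume eqv: "A \<equiv>\<^sub>2 B"
    then have "A \<le>\<^sub>2 B" "B \<le>\<^sub>2 A" by (simp_all add: equivalent2_def)
    from \<open>A \<le>\<^sub>2 B\<close> obtain h \<kappa> where h: "continuous_on UNIV h"
      and \<kappa>: "continuous_on {(x, w). sect A x \<noteq> {} \<and> w \<in> sect B (h x)} \<kappa>"
      and Bne: "\<And>x. sect A x \<noteq> {} \<Longrightarrow> sect B (h x) \<noteq> {}"
      and redA: "\<And>x w. sect A x \<noteq> {} \<Longrightarrow> w \<in> sect B (h x) \<Longrightarrow> \<kappa> (x, w) \<in> sect A x"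
      by (rule reducible2E) blast
    from \<open>B \<le>\<^sub>2 A\<close> obtain h' \<mu> where
      l: "continuous_on {(b, w). sect B b \<noteq> {} \<and> w \<in> sect A (h' b)} \<mu>"
      and redB: "\<And>b w. sect B b \<noteq> {} \<Longrightarrow> w \<in> sect A (h' b) \<Longrightarrow> \<mu> (b, w) \<in> sect B b"
      by (rule reducible2E) blast
    define D where "D = {(x, w). w \<in> sect A (h' (h x))}"
    have "continuous_on D (\<lambda>v. \<mu> (h (fst v), snd v))"
      using Bne[OF tot] unfolding D_def
      by (intro continuous_on_compose2[OF l] continuous_on_Pair continuous_on_compose2[OF h] continuous_intros) auto
    moreover have "\<exists>w\<in>cyl s. (x, w) \<in> D" for x s using dense by (simp add: D_def)
    ultimately obtain \<phi> where \<phi>: "continuous_on UNIV \<phi>"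
      "\<And>x n. \<exists>w. (x, w) \<in> D \<and> \<mu> (h x, w) \<in> cyl (stem (\<phi> x) n)"
      using dense_selection[of D "\<lambda>v. \<mu> (h (fst v), snd v)"] by auto
    \<comment> \<open>This is the place where the sections of \<open>B\<close> have to be closed.\<close>
    have \<phi>B: "\<phi> x \<in> sect B (h x)" for x
    proof (rule closed_mem_stem)
      show "closed (sect B (h x))" using that by (simp add: has_sections_def)
      show "\<exists>v\<in>sect B (h x). v \<in> cyl (stem (\<phi> x) n)" for n
        using \<phi>(2)[of x n] redB[OF Bne[OF tot]] unfolding D_def by blast
    qed
    have "continuous_on UNIV (\<lambda>x. \<kappa> (x, \<phi> x))"
      using tot \<phi>B by (intro continuous_on_compose2[OF \<kappa>] continuous_on_Pair \<phi>(1) continuous_intros) auto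
    then have "continuous_on UNIV (\<lambda>v :: baire \<times> baire. \<kappa> (fst v, \<phi> (fst v)))"
      by (rule continuous_on_compose2[OF _ continuous_on_fst[OF continuous_on_id]]) simp
    from exists_decoding_code[OF this]
    obtain E where E: "\<And>i x w. decodes (E i) (x, w) (\<kappa> (x, \<phi> x) i)" by auto
    define x where "x = of_rows E"
    have "\<kappa> (x, \<phi> x) \<in> sect A x" using redA[OF tot \<phi>B] .
    then have "\<exists>m. ?R x m (\<kappa> (x, \<phi> x) m)" by (auto simp: A_def)
    then show False using E by (simp add: x_def)
  qed
  ultimately show ?thesis using tot unfolding total_set_def by blast
qed

section \<open>Comparison of trees\<close>

text \<open>The length-preserving monotone map on finite sequences that is given by an arbitrary choice \<open>g\<close> of last entries. Every
function \<open>g\<close> is admissible, which makes quantification over such maps a quantification over Baire space.\<close>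

definition lip :: "(nat list \<Rightarrow> nat) \<Rightarrow> nat list \<Rightarrow> nat list" where
  "lip g \<sigma> = map (\<lambda>i. g (take (Suc i) \<sigma>)) [0..<length \<sigma>]"

definition tree :: "nat list set \<Rightarrow> bool" where
  "tree T \<longleftrightarrow> (\<forall>\<sigma> n. \<sigma> @ [n] \<in> T \<longrightarrow> \<sigma> \<in> T)"

definition illfounded :: "nat list set \<Rightarrow> bool" where
  "illfounded T \<longleftrightarrow> (\<exists>u. \<forall>n. stem u n \<in> T)"

text \<open>For well-founded trees this compares ranks, and an ill-founded tree is above all trees.\<close>

definition tree_le :: "nat list set \<Rightarrow> nat list set \<Rightarrow> bool" (infix "\<preceq>" 50) where
  "T \<preceq> T' \<longleftrightarrow> (\<exists>g. \<forall>\<sigma>\<in>T. lip g \<sigma> \<in> T')"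

lemma lip_Nil [simp]: "lip g [] = []" by (simp add: lip_def)

lemma lip_snoc [simp]: "lip g (\<sigma> @ [n]) = lip g \<sigma> @ [g (\<sigma> @ [n])]"
  by (simp add: lip_def)

lemma lip_stem: "lip g (stem u n) = stem (\<lambda>i. g (stem u (Suc i))) n"
  by (induction n) (simp_all add: stem_Suc)

lemma tree_le_illfounded: "T \<preceq> T' \<Longrightarrow> illfounded T \<Longrightarrow> illfounded T'"
  unfolding tree_le_def illfounded_def by (metis lip_stem)

lemma subset_tree_le: assumes "T \<subseteq> T'" shows "T \<preceq> T'"
proof -
  have "lip last \<sigma> = \<sigma>" for \<sigma> by (induction \<sigma> rule: rev_induct) simp_all
  then show ?thesis unfolding tree_le_def using assms by (intro exI[of _ last]) auto
qed

text \<open>A relation between positions that lets one follow every move in \<open>T\<close> by a move in \<open>T'\<close>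
is turned into a function of the last entries by replaying the moves from the root.\<close>

lemma strategy_tree_le:
  assumes T: "tree T" and init: "X [] []"
    and step: "\<And>\<sigma> \<tau> n. X \<sigma> \<tau> \<Longrightarrow> \<sigma> \<in> T \<Longrightarrow> \<exists>m. X (\<sigma> @ [n]) (\<tau> @ [m])"
    and safe: "\<And>\<sigma> \<tau>. X \<sigma> \<tau> \<Longrightarrow> \<sigma> \<in> T \<Longrightarrow> \<tau> \<in> T'"
  shows "T \<preceq> T'"
proof -
  obtain M where M: "\<And>\<sigma> \<tau> n. X \<sigma> \<tau> \<Longrightarrow> \<sigma> \<in> T \<Longrightarrow> X (\<sigma> @ [n]) (\<tau> @ [M \<sigma> \<tau> n])"
    using step by metis
  define play where "play \<sigma> = fold (\<lambda>n (\<sigma>, \<tau>). (\<sigma> @ [n], \<tau> @ [M \<sigma> \<tau> n])) \<sigma> ([], [])" for \<sigma>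
  define g where "g \<sigma> = last (snd (play \<sigma>))" for \<sigma>
  have play: "play \<sigma> = (\<sigma>, lip g \<sigma>)" for \<sigma>
  proof (induction \<sigma> rule: rev_induct)
    case Nil show ?case by (simp add: play_def)
  next
    case (snoc n \<sigma>)
    have "play (\<sigma> @ [n]) = (\<sigma> @ [n], lip g \<sigma> @ [M \<sigma> (lip g \<sigma>) n])"
      using snoc by (simp add: play_def)
    moreover from this have "g (\<sigma> @ [n]) = M \<sigma> (lip g \<sigma>) n"
      unfolding g_def[of "\<sigma> @ [n]"] by simp
    ultimately show ?case by simp
  qed
  have g: "g (\<sigma> @ [n]) = M \<sigma> (lip g \<sigma>) n" for \<sigma> n
    using play[of \<sigma>] by (simp add: g_def play_def)
  have "\<sigma> \<in> T \<longrightarrow> X \<sigma> (lip g \<sigma>)" for \<sigma>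
  proof (induction \<sigma> rule: rev_induct)
    case Nil show ?case by (simp add: init)
  next
    case (snoc n \<sigma>)
    then show ?case using T M g by (auto simp: tree_def)
  qed
  then show ?thesis unfolding tree_le_def using safe by blast
qed

text \<open>The player in \<open>T'\<close> can answer all further moves in \<open>T\<close> from the position \<open>(\<sigma>, \<tau>)\<close>. The game is closed for this
player, so the greatest fixed point describes the winning positions.\<close>

coinductive survives :: "nat list set \<Rightarrow> nat list set \<Rightarrow> nat list \<Rightarrow> nat list \<Rightarrow> bool" for T T' where
  "\<sigma> \<notin> T \<Longrightarrow> survives T T' \<sigma> \<tau>"
| "\<tau> \<in> T' \<Longrightarrow> \<forall>n. \<exists>m. survives T T' (\<sigma> @ [n]) (\<tau> @ [m]) \<Longrightarrow> survives T T' \<sigma> \<tau>"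

text \<open>If the player in \<open>T'\<close> does not survive, then from every lost position with \<open>\<tau> \<in> T'\<close> the opponent has a
move that loses against all answers. These moves follow the player in \<open>T'\<close> within \<open>T\<close>, and thus define a map in
the other direction.\<close>

lemma tree_le_total:
  assumes "tree T" "tree T'"
  shows "T \<preceq> T' \<or> T' \<preceq> T"
proof (cases "survives T T' [] []")
  case True
  have "T \<preceq> T'"
    by (rule strategy_tree_le[where X = "survives T T'"]) (use assms True in \<open>auto elim: survives.cases\<close>)
  then show ?thesis ..
next
  case False
  have "T' \<preceq> T"
  proof (rule strategy_tree_le[where X = "\<lambda>\<tau> \<sigma>. \<not> survives T T' \<sigma> \<tau>"])
    show "\<exists>m. \<not> survives T T' (\<tau> @ [m]) (\<sigma> @ [n])" if "\<not> survives T T' \<tau> \<sigma>" "\<sigma> \<in> T'" for \<sigma> \<tau> n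
      using that survives.intros(2) by metis
    show "\<tau> \<in> T" if "\<not> survives T T' \<tau> \<sigma>" for \<sigma> \<tau>
      using that survives.intros(1) by metis
  qed (use assms False in auto)
  then show ?thesis ..
qed

lemma analytic_tree_le:
  assumes T: "\<And>\<sigma>. locally_constant (\<lambda>x. \<sigma> \<in> T x)" and T': "\<And>\<sigma>. locally_constant (\<lambda>x. \<sigma> \<in> T' x)"
  shows "analytic {x. T x \<preceq> T' x}"
proof -
  have locally_constant_fst: "locally_constant (\<lambda>p :: 'a \<times> baire. P (fst p))"
    if "locally_constant P" for P :: "'a \<Rightarrow> bool"
    using that by (rule locally_constant_compose) (auto intro: continuous_intros)
  have "locally_constant (\<lambda>p :: 'a \<times> baire. lip (\<lambda>\<tau>. snd p (to_nat \<tau>)) \<sigma>)" for \<sigma>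
    unfolding lip_def by (intro locally_constant_map_list locally_constant_coord continuous_intros)
  then have "locally_constant (\<lambda>p. \<sigma> \<in> T (fst p) \<longrightarrow> lip (\<lambda>\<tau>. snd p (to_nat \<tau>)) \<sigma> \<in> T' (fst p))" for \<sigma>
    by (intro locally_constant_connectives locally_constant_fst T locally_constant_apply[where f = "\<lambda>p \<tau>. \<tau> \<in> T' (fst p)"] T')
  then have "analytic {p. \<forall>n. from_nat n \<in> T (fst p) \<longrightarrow>
      lip (\<lambda>\<tau>. snd p (to_nat \<tau>)) (from_nat n) \<in> T' (fst p)}"
    by (intro analytic_all analytic_locally_constant)
  then have "analytic {x. \<exists>w :: baire. \<forall>n. from_nat n \<in> T x \<longrightarrow>
      lip (\<lambda>\<tau>. w (to_nat \<tau>)) (from_nat n) \<in> T' x}"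
    by (rule analytic_ex_baire)
  moreover have "T x \<preceq> T' x \<longleftrightarrow> (\<exists>w :: baire. \<forall>n. from_nat n \<in> T x \<longrightarrow>
      lip (\<lambda>\<tau>. w (to_nat \<tau>)) (from_nat n) \<in> T' x)" for x
  proof
    assume "T x \<preceq> T' x"
    then obtain g where "\<forall>\<sigma>\<in>T x. lip g \<sigma> \<in> T' x" unfolding tree_le_def by blast
    then show "\<exists>w :: baire. \<forall>n. from_nat n \<in> T x \<longrightarrow> lip (\<lambda>\<tau>. w (to_nat \<tau>)) (from_nat n) \<in> T' x"
      by (intro exI[of _ "\<lambda>n. g (from_nat n)"]) simp
  next
    assume "\<exists>w :: baire. \<forall>n. from_nat n \<in> T x \<longrightarrow> lip (\<lambda>\<tau>. w (to_nat \<tau>)) (from_nat n) \<in> T' x"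
    then show "T x \<preceq> T' x" unfolding tree_le_def by (metis from_nat_to_nat)
  qed
  ultimately show ?thesis by simp
qed

section \<open>Witness trees of analytic sets\<close>

text \<open>An entry of a witness codes a pair: the entry of a point, and the entry of the certificate that the point
belongs to the analytic set.\<close>

definition proj :: "baire \<Rightarrow> baire" where
  "proj u = (\<lambda>j. fst (prod_decode (u j)))"

definition proj2 :: "baire \<Rightarrow> baire" where
  "proj2 u = (\<lambda>j. snd (prod_decode (u j)))"

text \<open>For closed \<open>C\<close> the branches are the points of the section at \<open>x\<close>. Membership of \<open>\<sigma>\<close>
depends only on the stem of \<open>x\<close> of the same length; this, rather than the tree of the section itself, makes
it locally constant in \<open>x\<close>.\<close>

definition stem_tree :: "(baire \<times> baire) set \<Rightarrow> baire \<Rightarrow> nat list set" where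
  "stem_tree C x = {\<sigma>. (cyl (stem x (length \<sigma>)) \<times> cyl \<sigma>) \<inter> C \<noteq> {}}"

text \<open>Only the entries of the point, not those of its certificate, are constrained.\<close>

definition restrict_tree :: "nat list set \<Rightarrow> (nat \<Rightarrow> nat \<Rightarrow> bool) \<Rightarrow> nat list set" where
  "restrict_tree T Q = {\<sigma>\<in>T. \<forall>j<length \<sigma>. Q j (fst (prod_decode (\<sigma> ! j)))}"

lemma continuous_proj: "continuous_on X f \<Longrightarrow> continuous_on X (\<lambda>x. proj (f x))"
  unfolding proj_def
  by (rule continuous_on_coordinatewise_then_product, rule locally_constant_imp_continuous, rule locally_constant_map) (rule locally_constant_coord)

lemma continuous_proj2: "continuous_on X f \<Longrightarrow> continuous_on X (\<lambda>x. proj2 (f x))"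
  unfolding proj2_def
  by (rule continuous_on_coordinatewise_then_product, rule locally_constant_imp_continuous, rule locally_constant_map) (rule locally_constant_coord)

lemma analytic_as_projection:
  fixes S :: "(baire \<times> baire) set"
  assumes "analytic S"
  obtains C where "closed C" "\<And>x w. (x, w) \<in> S \<longleftrightarrow> (\<exists>u. (x, u) \<in> C \<and> proj u = w)"
proof -
  from assms obtain F :: "((baire \<times> baire) \<times> baire) set" where F: "closed F" "S = fst ` F"
    unfolding analytic_def by blast
  have "closed ((\<lambda>p. ((fst p, proj (snd p)), proj2 (snd p))) -` F)"
    by (rule closed_vimage[OF F(1)]) (intro continuous_intros continuous_proj continuous_proj2)
  moreover have "(x, w) \<in> S \<longleftrightarrow> (\<exists>u. (x, u) \<in> (\<lambda>p. ((fst p, proj (snd p)), proj2 (snd p))) -` F \<and> proj u = w)" for x w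
  proof
    assume "(x, w) \<in> S"
    then obtain z where z: "((x, w), z) \<in> F" using F(2) by auto
    let ?u = "\<lambda>j. prod_encode (w j, z j)"
    have "proj ?u = w" "proj2 ?u = z" by (simp_all add: proj_def proj2_def)
    then show "\<exists>u. (x, u) \<in> (\<lambda>p. ((fst p, proj (snd p)), proj2 (snd p))) -` F \<and> proj u = w"
      using z by (intro exI[of _ ?u]) simp
  next
    assume "\<exists>u. (x, u) \<in> (\<lambda>p. ((fst p, proj (snd p)), proj2 (snd p))) -` F \<and> proj u = w"
    then show "(x, w) \<in> S" using F(2) by (force simp: image_iff)
  qed
  ultimately show ?thesis by (rule that)
qed

lemma tree_stem_tree: "tree (stem_tree C x)"
  unfolding tree_def
proof (intro allI impI)
  fix \<sigma> n assume "\<sigma> @ [n] \<in> stem_tree C x"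
  then obtain x' u where "x' \<in> cyl (stem x (Suc (length \<sigma>)))" "u \<in> cyl (\<sigma> @ [n])" "(x', u) \<in> C"
    unfolding stem_tree_def by auto
  moreover from this have "x' \<in> cyl (stem x (length \<sigma>))" "u \<in> cyl \<sigma>"
    by (auto simp: mem_cyl_iff nth_append)
  ultimately show "\<sigma> \<in> stem_tree C x" unfolding stem_tree_def by auto
qed

lemma branch_stem_tree:
  assumes "closed C"
  shows "(\<forall>n. stem u n \<in> stem_tree C x) \<longleftrightarrow> (x, u) \<in> C"
proof
  assume br: "\<forall>n. stem u n \<in> stem_tree C x"
  show "(x, u) \<in> C"
  proof (rule ccontr)
    assume "(x, u) \<notin> C"
    then obtain n where "cyl (stem x n) \<times> cyl (stem u n) \<subseteq> - C"
      using stem_nhds_prod[of "- C" x u] assms by (auto simp: open_Compl)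
    then show False using br[rule_format, of n] unfolding stem_tree_def by auto
  qed
next
  assume "(x, u) \<in> C"
  then have "(x, u) \<in> (cyl (stem x n) \<times> cyl (stem u n)) \<inter> C" for n by simp
  then show "\<forall>n. stem u n \<in> stem_tree C x" unfolding stem_tree_def by fastforce
qed

lemma tree_restrict: "tree T \<Longrightarrow> tree (restrict_tree T Q)"
  unfolding tree_def restrict_tree_def by (auto simp: nth_append)

lemma illfounded_restrict:
  assumes C: "closed C" "\<And>x w. (x, w) \<in> S \<longleftrightarrow> (\<exists>u. (x, u) \<in> C \<and> proj u = w)"
  shows "illfounded (restrict_tree (stem_tree C x) Q) \<longleftrightarrow> (\<exists>w. (x, w) \<in> S \<and> (\<forall>j. Q j (w j)))"
proof -
  have "(\<forall>n. stem u n \<in> restrict_tree (stem_tree C x) Q) \<longleftrightarrow> (x, u) \<in> C \<and> (\<forall>j. Q j (proj u j))" for u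
    unfolding branch_stem_tree[OF C(1), symmetric] restrict_tree_def proj_def by (auto intro: lessI)
  then show ?thesis unfolding illfounded_def using C(2) by auto
qed

lemma locally_constant_restrict: "locally_constant (\<lambda>x. \<sigma> \<in> T x) \<Longrightarrow> locally_constant (\<lambda>x. \<sigma> \<in> restrict_tree (T x) Q)"
  unfolding restrict_tree_def mem_Collect_eq by (intro locally_constant_connectives)

lemma locally_constant_stem_tree: "locally_constant (\<lambda>x. \<sigma> \<in> stem_tree C x)"
  using locally_constant_map[OF locally_constant_stem[OF continuous_on_id, of UNIV "length \<sigma>"], of "\<lambda>s. (cyl s \<times> cyl \<sigma>) \<inter> C \<noteq> {}"]
  by (simp add: stem_tree_def)

lemma tree_take: assumes "tree T" "\<sigma> \<in> T" shows "take k \<sigma> \<in> T"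
  using assms(2)
proof (induction \<sigma> rule: rev_induct)
  case (snoc n \<sigma>)
  then show ?case
    using assms(1) by (cases "k \<le> length \<sigma>") (auto simp: tree_def)
qed simp

section \<open>A universal set with compact homogeneous sections\<close>

lemma compact_product:
  fixes S :: "nat \<Rightarrow> nat set"
  assumes "\<And>n. finite (S n)"
  shows "compact {f. \<forall>n. f n \<in> S n}"
proof -
  have "compactin (product_topology (\<lambda>i. euclidean) UNIV) (Pi\<^sub>E UNIV S)"
    unfolding compactin_PiE using assms by (auto intro: finite_imp_compact)
  then have "compact (Pi\<^sub>E UNIV S)"
    by (simp add: euclidean_product_topology)
  then show ?thesis by (rule back_subst[of compact]) auto
qed

lemma compact_imp_closed_baire:
  fixes K :: "baire set"
  assumes "compact K"
  shows "closed K"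
proof -
  have "\<exists>U. open U \<and> y \<in> U \<and> U \<subseteq> - K" if "y \<in> - K" for y
  proof -
    have op: "open {v :: baire. v i \<noteq> y i}" for i
      by (intro locally_constant_open locally_constant_map[OF locally_constant_coord] continuous_on_id)
    have cov: "K \<subseteq> (\<Union>i. {v. v i \<noteq> y i})"
    proof
      fix v assume "v \<in> K"
      with that have "v \<noteq> y" by auto
      then show "v \<in> (\<Union>i. {v. v i \<noteq> y i})" by (auto simp: fun_eq_iff)
    qed
    obtain I where I: "finite I" "K \<subseteq> (\<Union>i\<in>I. {v. v i \<noteq> y i})"
      by (rule compactE_image[OF assms _ cov]) (rule op)
    obtain n where "\<forall>i\<in>I. i < n" using I(1) finite_nat_set_iff_bounded by blast
    then have "cyl (stem y n) \<subseteq> - K" using I(2) by (auto simp: mem_cyl_iff)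
    moreover have "open (cyl (stem y n))"
      using locally_constant_open[OF locally_constant_cyl[OF continuous_on_id]] by simp
    ultimately show ?thesis by (intro exI[of _ "cyl (stem y n)"]) simp
  qed
  then have "open (- K)" by (subst open_subopen) blast
  then show ?thesis by (simp add: closed_def)
qed

text \<open>The family of trees coded by \<open>z\<close>. Testing all initial segments turns every \<open>z\<close>
into a code of trees.\<close>

definition tree_family :: "baire \<Rightarrow> nat \<Rightarrow> nat \<Rightarrow> nat list set" where
  "tree_family z l i = {\<sigma>. \<forall>k<Suc (length \<sigma>). z (to_nat (l, i, take k \<sigma>)) = 0}"

text \<open>A condition on the entry \<open>v\<close> at position \<open>j\<close>. The two cases for \<open>i\<close> are the possible answers to the
question whether the entry after the stem \<open>s\<close> is \<open>n\<close> or larger, when it is known to be at least \<open>n\<close>.\<close>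

definition answer :: "nat list \<Rightarrow> nat \<Rightarrow> nat \<Rightarrow> nat \<Rightarrow> nat \<Rightarrow> bool" where
  "answer s n i j v \<longleftrightarrow> (j < length s \<longrightarrow> v = s ! j) \<and> (j = length s \<longrightarrow> (if i = 0 then v = n else n < v))"

text \<open>The point described by the answers \<open>y\<close>: the next entry is the first \<open>n\<close> at which the answer is
``equal to \<open>n\<close>''. If there is none the value is irrelevant, and the reduction is undefined at \<open>y\<close>.\<close>

primrec readout :: "baire \<Rightarrow> nat \<Rightarrow> nat list" where
  "readout y 0 = []"
| "readout y (Suc j) = readout y j @ [LEAST n :: nat. y (to_nat (readout y j, n)) = 0]"

lemma tree_tree_family: "tree (tree_family z l i)"
  unfolding tree_def tree_family_def
proof safe
  fix \<sigma> n k assume *: "\<forall>k<Suc (length (\<sigma> @ [n])). z (to_nat (l, i, take k (\<sigma> @ [n]))) = 0" and "k < Suc (length \<sigma>)"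
  then show "z (to_nat (l, i, take k \<sigma>)) = 0"
    using *[rule_format, of k] by simp
qed

text \<open>A point \<open>z\<close> codes countably many pairs of trees, and a solution selects from each pair a tree
that receives a map from the other one. The section is a product of nonempty subsets of \<open>{0, 1}\<close>. Given \<open>B\<close>, the pair of
index \<open>(s, n)\<close> consists of the witness trees for ``some member of \<open>B(x)\<close> extends \<open>s\<close> and has the next entry
\<open>n\<close>'' and ``\<dots> larger than \<open>n\<close>''.\<close>

lemma universal_compact_sections:
  "\<exists>A :: (baire \<times> baire) set.
     total_set A \<and> analytic A \<and> has_sections compact A \<and> has_sections homogeneous A \<and>
     (\<forall>B :: (baire \<times> baire) set. total_set B \<and> analytic B \<and> has_sections compact B \<longrightarrow> B \<le>\<^sub>1 A)"
proof -
  let ?S = tree_family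
  define V where "V z l = {v. v < 2 \<and> ?S z l (1 - v) \<preceq> ?S z l v}" for z l
  define A where "A = {(z, y :: baire). \<forall>l. y l \<in> V z l}"
  have sect_A: "sect A z = {y. \<forall>l. y l \<in> V z l}" for z by (auto simp: A_def)
  have V_ne: "V z l \<noteq> {}" for z l
  proof -
    have "?S z l 0 \<preceq> ?S z l 1 \<or> ?S z l 1 \<preceq> ?S z l 0"
      by (intro tree_le_total tree_tree_family)
    then have "1 \<in> V z l \<or> 0 \<in> V z l" by (auto simp: V_def)
    then show ?thesis by blast
  qed
  have "total_set A"
    unfolding total_set_def sect_A
  proof
    fix z
    have "(\<lambda>l. SOME v. v \<in> V z l) \<in> {y. \<forall>l. y l \<in> V z l}"
      using V_ne by (simp add: some_in_eq)
    then show "{y. \<forall>l. y l \<in> V z l} \<noteq> {}" by (metis empty_iff)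
  qed
  moreover have "has_sections homogeneous A"
    unfolding has_sections_def sect_A homogeneous_iff_product
  proof
    fix z
    have "(\<forall>n. V z n \<noteq> {}) \<and> {y. \<forall>l. y l \<in> V z l} = {f. \<forall>n. f n \<in> V z n}"
      by (intro conjI allI V_ne refl)
    then show "\<exists>S. (\<forall>n. S n \<noteq> {}) \<and> {y. \<forall>l. y l \<in> V z l} = {f. \<forall>n. f n \<in> S n}"
      by (rule exI[of _ "V z"])
  qed
  moreover have "has_sections compact A"
    unfolding has_sections_def sect_A
    by (intro allI compact_product finite_subset[OF _ finite_lessThan[of 2]]) (auto simp: V_def)
  moreover have "analytic A"
  proof -
    have "locally_constant (\<lambda>p :: baire \<times> baire. \<sigma> \<in> ?S (fst p) l i)" for \<sigma> l i
      unfolding tree_family_def mem_Collect_eq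
      by (intro locally_constant_connectives locally_constant_map2[where h = "(=)"] locally_constant_coord continuous_intros)
    then have lc: "locally_constant (\<lambda>p :: baire \<times> baire. \<sigma> \<in> ?S (fst p) l (f (snd p l)))" for \<sigma> l and f :: "nat \<Rightarrow> nat"
      by (rule locally_constant_apply[where n = "\<lambda>p. f (snd p l)"]) (intro locally_constant_map[OF locally_constant_coord] continuous_intros)
    have le: "analytic {p :: baire \<times> baire. ?S (fst p) l (1 - snd p l) \<preceq> ?S (fst p) l (snd p l)}" for l
      by (rule analytic_tree_le[OF lc[of _ l "\<lambda>v. 1 - v"] lc[of _ l "\<lambda>v. v"]])
    have lt: "locally_constant (\<lambda>p :: baire \<times> baire. snd p l < 2)" for l
      by (intro locally_constant_map[OF locally_constant_coord] continuous_intros)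
    have "analytic {p :: baire \<times> baire. \<forall>l. snd p l < 2 \<and> ?S (fst p) l (1 - snd p l) \<preceq> ?S (fst p) l (snd p l)}"
      by (intro analytic_all analytic_conj[OF analytic_locally_constant[OF lt] le])
    then show ?thesis by (simp add: A_def V_def case_prod_unfold)
  qed
  moreover have "B \<le>\<^sub>1 A" if B: "total_set B" "analytic B" "has_sections compact B" for B :: "(baire \<times> baire) set"
  proof -
    obtain C where C: "closed C" "\<And>x w. (x, w) \<in> B \<longleftrightarrow> (\<exists>u. (x, u) \<in> C \<and> proj u = w)"
      using analytic_as_projection[OF B(2)] by blast
    let ?T = "\<lambda>x s n i. restrict_tree (stem_tree C x) (answer s n i)"
    define h :: "baire \<Rightarrow> baire" where "h x = (\<lambda>k. case from_nat k of (l :: nat, i, \<sigma>) \<Rightarrow>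
        case from_nat l of (s, n) \<Rightarrow> if \<sigma> \<in> ?T x s n i then 0 else 1)" for x
    have h: "?S (h x) (to_nat (s, n)) i = ?T x s n i" for x s n i
    proof -
      have "tree (?T x s n i)" by (intro tree_restrict tree_stem_tree)
      then have "(\<forall>k<Suc (length \<sigma>). take k \<sigma> \<in> ?T x s n i) \<longleftrightarrow> \<sigma> \<in> ?T x s n i" for \<sigma>
        using tree_take by (metis lessI order_refl take_all)
      then show ?thesis by (auto simp: tree_family_def h_def)
    qed
    have "locally_constant (\<lambda>x. h x k)" for k
      unfolding h_def case_prod_unfold
      by (rule locally_constant_map[where h = "\<lambda>b. if b then 0 else 1"]) (intro locally_constant_restrict locally_constant_stem_tree)
    then have cont_h: "continuous_on UNIV h"
      by (intro continuous_on_coordinatewise_then_product locally_constant_imp_continuous)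
    let ?D = "{y :: baire. \<forall>j. \<exists>n :: nat. y (to_nat (readout y j, n)) = 0}"
    define p :: "baire \<Rightarrow> baire" where "p y j = (LEAST n :: nat. y (to_nat (readout y j, n)) = 0)" for y :: baire and j
    define k where "k y = (if y \<in> ?D then Some (p y) else None)" for y
    have stem_p: "stem (p y) j = readout y j" for y j
      by (induction j) (simp_all add: stem_Suc p_def)
    have locally_constant_code: "locally_constant_on ?D (\<lambda>y. y (to_nat (r y, n)) = 0)" if "locally_constant_on ?D r"
      for r :: "baire \<Rightarrow> nat list" and n :: nat
    proof -
      have "locally_constant_on ?D (\<lambda>y. to_nat (r y, n))" using that by (rule locally_constant_map)
      then have "locally_constant_on ?D (\<lambda>y. y (to_nat (r y, n)))"
        by (rule locally_constant_apply[where f = "\<lambda>y. y", rotated]) (intro locally_constant_coord continuous_on_id)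
      then show ?thesis by (rule locally_constant_map)
    qed
    have locally_constant_readout: "locally_constant_on ?D (\<lambda>y. readout y j)" for j
    proof (induction j)
      case 0 show ?case by (simp add: locally_constant_const)
    next
      case (Suc j)
      have "locally_constant_on ?D (\<lambda>y. LEAST n :: nat. y (to_nat (readout y j, n)) = 0)"
        by (intro locally_constant_LEAST locally_constant_code Suc.IH) blast
      from locally_constant_map2[OF Suc.IH this, of "\<lambda>s n. s @ [n]"] show ?case by simp
    qed
    have "locally_constant_on ?D (\<lambda>y. p y j)" for j
      unfolding p_def by (intro locally_constant_LEAST locally_constant_code locally_constant_readout) blast
    then have "continuous_on ?D p"
      by (intro continuous_on_coordinatewise_then_product locally_constant_imp_continuous)
    moreover have "dom k = ?D" by (auto simp: k_def dom_def)
    moreover have "continuous_on ?D (\<lambda>y. the (k y)) \<longleftrightarrow> continuous_on ?D p"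
      by (rule continuous_on_cong) (auto simp: k_def)
    ultimately have "partial_continuous k" by (simp add: partial_continuous_def)
    have correct: "y \<in> ?D \<and> p y \<in> sect B x" if y: "y \<in> sect A (h x)" for x y
    proof -
      \<comment> \<open>Following the answers preserves the existence of a member of \<open>B(x)\<close> that extends \<open>s\<close> with the next
entry at least \<open>n\<close>: one of the two trees is then ill-founded, hence so is the selected one.\<close>
      define alive where "alive s n \<longleftrightarrow> (\<exists>w\<in>sect B x. w \<in> cyl s \<and> n \<le> w (length s))" for s n
      have ill: "illfounded (?T x s n i) \<longleftrightarrow>
          (\<exists>w\<in>sect B x. w \<in> cyl s \<and> (if i = 0 then w (length s) = n else n < w (length s)))" for s n i
        unfolding illfounded_restrict[OF C] answer_def by (auto simp: mem_cyl_iff)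
      have step: "if y (to_nat (s, n)) = 0 then alive (s @ [n]) 0 else alive s (Suc n)" if "alive s n" for s n
      proof -
        let ?v = "y (to_nat (s, n))"
        have "?v \<in> V (h x) (to_nat (s, n))" using y unfolding sect_A by blast
        then have v: "?v < 2" "?T x s n (1 - ?v) \<preceq> ?T x s n ?v"
          unfolding V_def h by simp_all
        have "illfounded (?T x s n 0) \<or> illfounded (?T x s n 1)"
          using \<open>alive s n\<close> unfolding ill alive_def by (auto simp: le_less)
        then have "illfounded (?T x s n ?v)"
          using v tree_le_illfounded[OF v(2)] by (cases "?v = 0") (auto simp: less_2_cases_iff)
        then obtain w where w: "w \<in> sect B x" "w \<in> cyl s"
          "if ?v = 0 then w (length s) = n else n < w (length s)"
          unfolding ill by blast
        show ?thesis
        proof (cases "?v = 0")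
          case True
          then have "w \<in> cyl (s @ [n])"
            using w by (auto simp: mem_cyl_iff nth_append less_Suc_eq)
          then show ?thesis using True w(1) unfolding alive_def by auto
        next
          case False
          then show ?thesis using w unfolding alive_def by auto
        qed
      qed
      have stop: "\<exists>n :: nat. y (to_nat (s, n)) = 0" if "alive s 0" for s
      proof (rule ccontr)
        assume "\<nexists>n :: nat. y (to_nat (s, n)) = 0"
        then have al: "alive s n" for n
          using step[of s] that by (induction n) auto
        \<comment> \<open>By compactness the entries at this position are bounded.\<close>
        have "compact ((\<lambda>w. w (length s)) ` sect B x)"
        proof (rule compact_continuous_image)
          show "continuous_on (sect B x) (\<lambda>w. w (length s))"
            by (rule continuous_on_product_then_coordinatewise[OF continuous_on_id])
          show "compact (sect B x)" using B(3) by (simp add: has_sections_def)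
        qed
        moreover have "sect B x \<noteq> {}" using B(1) by (simp add: total_set_def)
        ultimately obtain m where "\<And>w. w \<in> sect B x \<Longrightarrow> w (length s) \<le> m"
          using compact_attains_sup[of "(\<lambda>w. w (length s)) ` sect B x"] by auto
        then show False using al[of "Suc m"] unfolding alive_def by fastforce
      qed
      have next_alive: "alive (s @ [LEAST n :: nat. y (to_nat (s, n)) = 0]) 0" if "alive s 0" for s
      proof -
        let ?N = "LEAST n :: nat. y (to_nat (s, n)) = 0"
        have "n \<le> ?N \<longrightarrow> alive s n" for n
        proof (induction n)
          case (Suc n)
          then show ?case using step[of s n] not_less_Least[of n "\<lambda>n :: nat. y (to_nat (s, n)) = 0"] by auto
        qed (use that in simp)
        then show ?thesis using step[of s ?N] LeastI_ex[OF stop[OF that]] by auto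
      qed
      have alive: "alive (readout y j) 0" for j
      proof (induction j)
        case 0
        show ?case using B(1) unfolding alive_def total_set_def by (auto simp: mem_cyl_iff)
      qed (simp add: next_alive)
      have "y \<in> ?D" using stop alive by blast
      moreover have "p y \<in> sect B x"
      proof (rule closed_mem_stem)
        show "closed (sect B x)" using B(3) unfolding has_sections_def by (intro compact_imp_closed_baire) simp
        show "\<exists>v\<in>sect B x. v \<in> cyl (stem (p y) j)" for j
          using alive[of j] unfolding stem_p alive_def by blast
      qed
      ultimately show ?thesis by blast
    qed
    have "is_choice B (\<lambda>x. Option.bind (g (h x)) k)" if g: "is_choice A g" for g
      unfolding is_choice_def
    proof (intro allI impI)
      fix x
      obtain y where y: "g (h x) = Some y" "y \<in> sect A (h x)"
        using g \<open>total_set A\<close> unfolding is_choice_def total_set_def by blast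
      then show "\<exists>w. Option.bind (g (h x)) k = Some w \<and> w \<in> sect B x"
        using correct[OF y(2)] by (simp add: k_def)
    qed
    then show ?thesis unfolding reducible1_def using cont_h \<open>partial_continuous k\<close> by blast
  qed
  ultimately show ?thesis by blast
qed

section \<open>A set that is not below homogeneous sections\<close>

text \<open>Row \<open>0\<close> of \<open>x\<close> codes a closed subset of the square by its tree, and this is the tree of its section at
\<open>x\<close> itself.\<close>

definition coded_tree :: "baire \<Rightarrow> nat list set" where
  "coded_tree x = {\<sigma>. \<forall>k<Suc (length \<sigma>). row x 0 (to_nat (stem x k, take k \<sigma>)) = 0}"

definition box_stem :: "nat \<Rightarrow> nat list" where
  "box_stem l = snd (from_nat l :: nat list \<times> nat list)"

text \<open>Row \<open>1\<close> of \<open>x\<close> claims that \<open>k(x, w)(0) = j\<close> for all \<open>w\<close> that extend \<open>box_stem l\<close>.\<close>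

definition predicts :: "baire \<Rightarrow> nat \<Rightarrow> nat \<Rightarrow> bool" where
  "predicts x l j \<longleftrightarrow> j < 2 \<and> x \<in> cyl (fst (from_nat l :: nat list \<times> nat list)) \<and> row x 1 l = Suc j"

text \<open>Ill-founded iff some member of the coded section extends \<open>box_stem l\<close>; the next tree is ill-founded iff some
member has \<open>i\<close>-th entry \<open>m\<close>.\<close>

definition stem_witnesses :: "baire \<Rightarrow> nat \<Rightarrow> nat list set" where
  "stem_witnesses x l = restrict_tree (coded_tree x) (\<lambda>j v. j < length (box_stem l) \<longrightarrow> v = box_stem l ! j)"

definition entry_witnesses :: "baire \<Rightarrow> nat \<Rightarrow> nat \<Rightarrow> nat list set" where
  "entry_witnesses x i m = restrict_tree (coded_tree x) (\<lambda>j v. j = i \<longrightarrow> v = m)"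

text \<open>In the sense of ranks, the stem of some earlier prediction \<open>l0\<close> survives at least as long as every entry at
some coordinate \<open>i\<close>. This holds whenever the demand at \<open>l0\<close> is unsolvable, and then it waives the demands of
all later predictions. It fails if the coded section is nonempty but has no member with the stem of \<open>l0\<close>.\<close>

definition blocked :: "baire \<Rightarrow> nat \<Rightarrow> bool" where
  "blocked x l \<longleftrightarrow> (\<exists>l0. l0 < l \<and> (\<exists>j. predicts x l0 j) \<and>
     (\<exists>i. \<forall>m. entry_witnesses x i m \<preceq> stem_witnesses x l0))"

text \<open>The number \<open>q\<close> exceeds the entry \<open>Suc l\<close> of \<open>k(x, w)\<close> for a candidate \<open>w\<close> with stem \<open>box_stem l\<close>, where row
\<open>Suc (Suc l)\<close> codes this entry. The candidate is required to belong to the section only coordinatewise, and only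
up to the rank of the witness tree of the stem. If that tree is ill-founded, every single entry of \<open>w\<close> is
the entry of some member, which suffices for homogeneous sections.\<close>

definition permits :: "baire \<Rightarrow> nat \<Rightarrow> nat \<Rightarrow> bool" where
  "permits x l q \<longleftrightarrow> blocked x l \<or> (\<exists>w. w \<in> cyl (box_stem l) \<and>
     (\<forall>i. stem_witnesses x l \<preceq> entry_witnesses x i (w i)) \<and>
     (\<forall>m. decodes (row x (Suc (Suc l))) (x, w) m \<longrightarrow> m < q))"

text \<open>The case distinction on \<open>y 0\<close> makes a single unsolvable demand harmless, as it binds one side only.\<close>

definition hard_set :: "(baire \<times> baire) set" where
  "hard_set = {(x, y). y 0 < 2 \<and> (\<forall>l. predicts x l (y 0) \<longrightarrow> permits x l (y (Suc l)))}"

lemma tree_coded_tree: "tree (coded_tree x)"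
  unfolding tree_def coded_tree_def
proof safe
  fix \<sigma> n k
  assume *: "\<forall>k<Suc (length (\<sigma> @ [n])). row x 0 (to_nat (stem x k, take k (\<sigma> @ [n]))) = 0"
    and "k < Suc (length \<sigma>)"
  then show "row x 0 (to_nat (stem x k, take k \<sigma>)) = 0"
    using *[rule_format, of k] by simp
qed

text \<open>A demand at \<open>l\<close> is unsolvable only if some coordinate has no entry whose witness tree is above that
of the stem. As trees are comparable, all later demands are then blocked. So at most one demand is unsolvable, and it
concerns one side only.\<close>

lemma hard_set_total: "total_set hard_set"
  unfolding total_set_def
proof
  fix x
  have stuck: "\<exists>i. \<forall>m. entry_witnesses x i m \<preceq> stem_witnesses x l" if none: "\<And>q. \<not> permits x l q" for l
  proof (rule ccontr)
    assume "\<not> ?thesis"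
    then have "\<exists>m. \<not> entry_witnesses x i m \<preceq> stem_witnesses x l" for i by blast
    then have "\<exists>m. stem_witnesses x l \<preceq> entry_witnesses x i m" for i
      using tree_le_total tree_restrict[OF tree_coded_tree]
      unfolding entry_witnesses_def stem_witnesses_def by meson
    then obtain r where r: "\<And>i. stem_witnesses x l \<preceq> entry_witnesses x i (r i)" by metis
    \<comment> \<open>On the stem itself the witness trees are nested; elsewhere the chosen entries are used.\<close>
    let ?w = "\<lambda>i. if i < length (box_stem l) then box_stem l ! i else r i"
    have "stem_witnesses x l \<preceq> entry_witnesses x i (?w i)" for i
    proof (cases "i < length (box_stem l)")
      case True
      then have "stem_witnesses x l \<subseteq> entry_witnesses x i (?w i)"
        by (auto simp: stem_witnesses_def entry_witnesses_def restrict_tree_def)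
      then show ?thesis by (rule subset_tree_le)
    qed (simp add: r)
    moreover have "?w \<in> cyl (box_stem l)" by (simp add: mem_cyl_iff)
    moreover have "\<exists>q. \<forall>m. decodes (row x (Suc (Suc l))) (x, ?w) m \<longrightarrow> m < q"
      by (metis decodes_unique lessI)
    ultimately show False using none unfolding permits_def by blast
  qed
  have unique: "l = l'" if "predicts x l j" "\<And>q. \<not> permits x l q" "predicts x l' j'" "\<And>q. \<not> permits x l' q" for l j l' j'
  proof (rule ccontr)
    assume "l \<noteq> l'"
    then consider "l < l'" | "l' < l" by linarith
    then show False
    proof cases
      case 1
      then have "blocked x l'" unfolding blocked_def using that(1) stuck[OF that(2)] by blast
      then show ?thesis using that(4) unfolding permits_def by blast
    next
      case 2
      then have "blocked x l" unfolding blocked_def using that(3) stuck[OF that(4)] by blast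
      then show ?thesis using that(2) unfolding permits_def by blast
    qed
  qed
  have "\<exists>j<2. \<forall>l. predicts x l j \<longrightarrow> (\<exists>q. permits x l q)"
  proof (rule ccontr)
    assume "\<not> ?thesis"
    then have *: "\<exists>l. predicts x l j \<and> (\<forall>q. \<not> permits x l q)" if "j < 2" for j using that by blast
    obtain l l' where "predicts x l 0" "\<forall>q. \<not> permits x l q" "predicts x l' 1" "\<forall>q. \<not> permits x l' q"
      using *[of 0] *[of 1] by auto
    moreover from this have "l = l'" using unique by blast
    ultimately show False by (simp add: predicts_def)
  qed
  then obtain j r where j: "j < 2" "\<And>l. predicts x l j \<Longrightarrow> permits x l (r l)" by metis
  let ?y = "\<lambda>i. case i of 0 \<Rightarrow> j | Suc l \<Rightarrow> r l"
  have "(x, ?y) \<in> hard_set" using j by (simp add: hard_set_def)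
  then show "sect hard_set x \<noteq> {}" by blast
qed

lemma hard_set_analytic: "analytic hard_set"
proof -
  let ?x = "\<lambda>r :: (baire \<times> baire) \<times> baire. fst (fst r)"
  have locally_constant_entry_0: "locally_constant (\<lambda>x. row x 0 (to_nat (stem x k, s)))" for k and s :: "nat list"
  proof (rule locally_constant_apply[where f = "\<lambda>x. row x 0"])
    show "locally_constant (\<lambda>x. row x 0 n)" for n
      by (intro locally_constant_coord continuous_intros)
    show "locally_constant (\<lambda>x :: baire. to_nat (stem x k, s))"
      by (rule locally_constant_map[where f = "\<lambda>x. stem x k"]) (intro locally_constant_stem continuous_on_id)
  qed
  have locally_constant_tree: "locally_constant (\<lambda>x. \<sigma> \<in> coded_tree x)" for \<sigma>
    unfolding coded_tree_def mem_Collect_eq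
    by (intro locally_constant_all_less locally_constant_map[where h = "\<lambda>v. v = 0"] locally_constant_entry_0)
  have locally_constant_stem: "locally_constant (\<lambda>x. \<sigma> \<in> stem_witnesses x l)" for \<sigma> l
    unfolding stem_witnesses_def by (intro locally_constant_restrict locally_constant_tree)
  have locally_constant_entry: "locally_constant (\<lambda>x. \<sigma> \<in> entry_witnesses x i m)" for \<sigma> i m
    unfolding entry_witnesses_def by (intro locally_constant_restrict locally_constant_tree)
  have locally_constant_predicts: "locally_constant (\<lambda>x. predicts x l j)" for l j
    unfolding predicts_def
    by (intro locally_constant_connectives locally_constant_cyl locally_constant_map2[where h = "(=)"] locally_constant_coord continuous_intros)
  have blocked: "analytic {x. blocked x l}" for l
    unfolding blocked_def
    by (intro analytic_ex analytic_conj analytic_all analytic_tree_le analytic_locally_constant locally_constant_const locally_constant_predicts locally_constant_stem locally_constant_entry)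
  have x: "continuous_on UNIV ?x" by (intro continuous_intros)
  have "locally_constant (\<lambda>r. \<sigma> \<in> entry_witnesses (?x r) i (snd r i))" for \<sigma> i
  proof (rule locally_constant_apply[where f = "\<lambda>r m. \<sigma> \<in> entry_witnesses (?x r) i m"])
    show "locally_constant (\<lambda>r. \<sigma> \<in> entry_witnesses (?x r) i m)" for m
      by (rule locally_constant_compose[OF locally_constant_entry x]) simp
    show "locally_constant (\<lambda>r :: (baire \<times> baire) \<times> baire. snd r i)"
      by (intro locally_constant_coord continuous_intros)
  qed
  moreover have "locally_constant (\<lambda>r. \<sigma> \<in> stem_witnesses (?x r) l)" for \<sigma> l
    by (rule locally_constant_compose[OF locally_constant_stem x]) simp
  ultimately have le: "analytic {r. \<forall>i. stem_witnesses (?x r) l \<preceq> entry_witnesses (?x r) i (snd r i)}" for l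
    by (intro analytic_all analytic_tree_le)
  have small: "analytic {r. \<forall>m. decodes (row (?x r) (Suc (Suc l))) (?x r, snd r) m \<longrightarrow> m < snd (fst r) (Suc l)}" for l
    unfolding imp_conv_disj
    by (intro analytic_all analytic_disj analytic_closed[OF closed_not_decodes] continuous_intros locally_constant_const
        analytic_locally_constant locally_constant_map[OF locally_constant_coord])
  have cyl: "analytic {r :: (baire \<times> baire) \<times> baire. snd r \<in> cyl (box_stem l)}" for l
    by (intro analytic_locally_constant locally_constant_cyl continuous_intros)
  have permits: "analytic {p :: baire \<times> baire. permits (fst p) l (snd p (Suc l))}" for l
    unfolding permits_def
    by (intro analytic_disj analytic_compose[OF blocked] analytic_ex_baire analytic_conj cyl le small continuous_intros)
  have predicts: "locally_constant (\<lambda>p :: baire \<times> baire. predicts (fst p) l (snd p 0))" for l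
  proof (rule locally_constant_apply[where f = "\<lambda>p j. predicts (fst p) l j"])
    show "locally_constant (\<lambda>p :: baire \<times> baire. predicts (fst p) l j)" for j
      by (rule locally_constant_compose[OF locally_constant_predicts]) (auto intro: continuous_intros)
    show "locally_constant (\<lambda>p :: baire \<times> baire. snd p 0)"
      by (intro locally_constant_coord continuous_intros)
  qed
  have "locally_constant (\<lambda>p :: baire \<times> baire. snd p 0 < 2)"
    by (intro locally_constant_map[OF locally_constant_coord] continuous_intros)
  then have "analytic {p :: baire \<times> baire. snd p 0 < 2 \<and>
      (\<forall>l. predicts (fst p) l (snd p 0) \<longrightarrow> permits (fst p) l (snd p (Suc l)))}"
    unfolding imp_conv_disj
    by (intro analytic_conj analytic_all analytic_disj permits analytic_locally_constant[OF locally_constant_connectives(1)[OF predicts]] analytic_locally_constant)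
  then show ?thesis by (simp add: hard_set_def case_prod_unfold)
qed

text \<open>The point \<open>x\<close> codes the reduction, and \<open>l\<close> is the least prediction whose stem has an extension in the
section \<open>B(h(x))\<close>. The earlier stems have well-founded witness trees while every coordinate has an entry with an
ill-founded one, so \<open>l\<close> is not blocked. Its demand refers to actual members of \<open>B(h(x))\<close>, by homogeneity, and
the member that minimizes the entry \<open>Suc l\<close> violates it.\<close>

lemma hard_set_not_reducible:
  fixes B :: "(baire \<times> baire) set"
  assumes tot: "total_set B" and an: "analytic B" and hom: "has_sections homogeneous B"
  shows "\<not> hard_set \<le>\<^sub>2 B"
proof
  assume "hard_set \<le>\<^sub>2 B"
  then obtain h \<kappa> where h: "continuous_on UNIV h"
    and \<kappa>: "continuous_on {(x, w). sect hard_set x \<noteq> {} \<and> w \<in> sect B (h x)} \<kappa>"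
    and red: "\<And>x w. sect hard_set x \<noteq> {} \<Longrightarrow> w \<in> sect B (h x) \<Longrightarrow> \<kappa> (x, w) \<in> sect hard_set x"
    by (rule reducible2E) blast
  have ne: "sect hard_set x \<noteq> {}" for x using hard_set_total by (simp add: total_set_def)
  define S where "S = {(x, w). w \<in> sect B (h x)}"
  have "continuous_on UNIV (\<lambda>p :: baire \<times> baire. (h (fst p), snd p))"
    by (intro continuous_on_Pair continuous_on_compose2[OF h] continuous_intros) auto
  then have "analytic {p :: baire \<times> baire. (h (fst p), snd p) \<in> B}"
    by (rule analytic_compose[of "\<lambda>v. v \<in> B", rotated]) (simp add: an)
  then have "analytic S" by (simp add: S_def case_prod_unfold)
  then obtain C where C: "closed C" "\<And>x w. (x, w) \<in> S \<longleftrightarrow> (\<exists>u. (x, u) \<in> C \<and> proj u = w)"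
    using analytic_as_projection by blast
  have "continuous_on S \<kappa>" using \<kappa> ne by (simp add: S_def)
  from exists_code[OF this] obtain E :: "nat \<Rightarrow> baire" where
    E1: "\<And>i x w. (x, w) \<in> S \<Longrightarrow> \<exists>K. \<forall>k\<ge>K. E i (to_nat (stem x k, stem w k)) = Suc (\<kappa> (x, w) i)" and
    E2: "\<And>i v n m. v \<in> S \<Longrightarrow> v \<in> box n \<Longrightarrow> E i n = Suc m \<Longrightarrow> \<kappa> v i = m"
    by blast
  have E: "decodes (E i) (x, w) (\<kappa> (x, w) i)" if "(x, w) \<in> S" for i x w
    by (rule decodes_code[OF E1[OF that] E2[OF that]])
  define e :: baire where "e n = (if box n \<inter> C = {} then 1 else 0)" for n
  define x where "x = of_rows (\<lambda>i. case i of 0 \<Rightarrow> e | Suc i \<Rightarrow> E i)"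
  have row_x: "row x 0 = e" "\<And>i. row x (Suc i) = E i" by (simp_all add: x_def)
  have "coded_tree x = stem_tree C x"
  proof -
    have "(\<forall>k<Suc (length \<sigma>). take k \<sigma> \<in> stem_tree C x) \<longleftrightarrow> \<sigma> \<in> stem_tree C x" for \<sigma>
      using tree_take[OF tree_stem_tree] by (metis lessI order_refl take_all)
    moreover have "row x 0 (to_nat (stem x k, take k \<sigma>)) = 0 \<longleftrightarrow> take k \<sigma> \<in> stem_tree C x"
      if "k < Suc (length \<sigma>)" for k \<sigma>
      using that by (cases "k = length \<sigma>") (simp_all add: row_x e_def box_def stem_tree_def min_def)
    ultimately show ?thesis unfolding coded_tree_def by blast
  qed
  then have ill: "illfounded (restrict_tree (coded_tree x) Q) \<longleftrightarrow> (\<exists>w\<in>sect B (h x). \<forall>j. Q j (w j))" for Q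
    using illfounded_restrict[OF C] by (auto simp: S_def)
  have ill_stem: "illfounded (stem_witnesses x l) \<longleftrightarrow> (\<exists>w\<in>sect B (h x). w \<in> cyl (box_stem l))" for l
    unfolding stem_witnesses_def ill by (auto simp: mem_cyl_iff)
  have ill_entry: "illfounded (entry_witnesses x i m) \<longleftrightarrow> (\<exists>w\<in>sect B (h x). w i = m)" for i m
    unfolding entry_witnesses_def ill by auto
  have in_S: "(x, w) \<in> S \<longleftrightarrow> w \<in> sect B (h x)" for w by (simp add: S_def)
  let ?live = "\<lambda>l. (\<exists>j. predicts x l j) \<and> illfounded (stem_witnesses x l)"
  obtain w0 where w0: "w0 \<in> sect B (h x)" using tot unfolding total_set_def by blast
  \<comment> \<open>By continuity, a small box around any \<open>w0\<close> in the section carries a correct prediction.\<close>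
  have "\<exists>l. ?live l"
  proof -
    obtain K where "E 0 (to_nat (stem x K, stem w0 K)) = Suc (\<kappa> (x, w0) 0)"
      using E1[of x w0 0] w0 in_S by blast
    moreover have "\<kappa> (x, w0) 0 < 2" using red[OF ne w0] by (simp add: hard_set_def)
    moreover have "\<exists>w\<in>sect B (h x). w \<in> cyl (stem w0 K)" using w0 stem_in_cyl by blast
    ultimately have "?live (to_nat (stem x K, stem w0 K))"
      unfolding ill_stem by (simp add: predicts_def row_x box_stem_def)
    then show ?thesis by blast
  qed
  then obtain l where "?live l" and least: "\<And>l'. l' < l \<Longrightarrow> \<not> ?live l'"
    using exists_least_iff[of ?live] by blast
  then obtain j where j: "predicts x l j" and l: "illfounded (stem_witnesses x l)" by blast
  have "\<not> blocked x l"
  proof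
    assume "blocked x l"
    then obtain l0 i where l0: "l0 < l" "\<exists>j. predicts x l0 j"
      and le: "\<And>m. entry_witnesses x i m \<preceq> stem_witnesses x l0"
      unfolding blocked_def by blast
    have "illfounded (entry_witnesses x i (w0 i))" using w0 unfolding ill_entry by blast
    then have "illfounded (stem_witnesses x l0)" by (rule tree_le_illfounded[OF le])
    then show False using least l0 by blast
  qed
  let ?W = "\<lambda>w. w \<in> sect B (h x) \<and> w \<in> cyl (box_stem l)"
  obtain w1 where "?W w1" using l unfolding ill_stem by blast
  then obtain w where w: "?W w" and min: "\<And>w'. ?W w' \<Longrightarrow> \<kappa> (x, w) (Suc l) \<le> \<kappa> (x, w') (Suc l)"
    using ex_has_least_nat[of ?W w1 "\<lambda>w. \<kappa> (x, w) (Suc l)"] by blast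
  have "(x, w) \<in> box l"
    using j w by (simp add: predicts_def box_def box_stem_def case_prod_unfold)
  moreover have "E 0 l = Suc j" using j row_x(2)[of 0] by (simp add: predicts_def)
  ultimately have "\<kappa> (x, w) 0 = j" using E2[of "(x, w)" l 0 j] w in_S by blast
  then have "permits x l (\<kappa> (x, w) (Suc l))"
    using red[OF ne, of w x] w j by (auto simp: hard_set_def)
  then obtain w' where w': "w' \<in> cyl (box_stem l)"
    "\<And>i. stem_witnesses x l \<preceq> entry_witnesses x i (w' i)"
    "\<And>m. decodes (E (Suc l)) (x, w') m \<Longrightarrow> m < \<kappa> (x, w) (Suc l)"
    unfolding permits_def row_x using \<open>\<not> blocked x l\<close> by blast
  obtain P where P: "sect B (h x) = {f. \<forall>n. f n \<in> P n}"
    using hom unfolding has_sections_def homogeneous_iff_product by blast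
  have "w' i \<in> P i" for i
  proof -
    have "illfounded (entry_witnesses x i (w' i))" by (rule tree_le_illfounded[OF w'(2) l])
    then obtain v where "v \<in> sect B (h x)" "v i = w' i" unfolding ill_entry by blast
    then show ?thesis unfolding P by (metis mem_Collect_eq)
  qed
  then have "w' \<in> sect B (h x)" unfolding P by blast
  then have "\<kappa> (x, w') (Suc l) < \<kappa> (x, w) (Suc l)" using w'(3) E in_S by blast
  then show False using min[of w'] w'(1) \<open>w' \<in> sect B (h x)\<close> by simp
qed

text \<open>Adding a certificate to each element turns an analytic set into a closed one to
which it is reducible by a projection.\<close>

lemma closed_set_not_below_homogeneous:
  "\<exists>A :: (baire \<times> baire) set. total_set A \<and> closed A \<and>
     (\<forall>B :: (baire \<times> baire) set. total_set B \<and> analytic B \<and> has_sections homogeneous B \<longrightarrow> \<not> A \<le>\<^sub>2 B)"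
proof -
  obtain C where C: "closed C" "\<And>x y. (x, y) \<in> hard_set \<longleftrightarrow> (\<exists>u. (x, u) \<in> C \<and> proj u = y)"
    using analytic_as_projection[OF hard_set_analytic] by blast
  have "total_set C"
    using hard_set_total C(2) unfolding total_set_def by fastforce
  moreover have "hard_set \<le>\<^sub>2 B" if "C \<le>\<^sub>2 B" for B :: "(baire \<times> baire) set"
  proof -
    from that obtain h k where h: "continuous_on UNIV h" and k: "partial_continuous k"
      and red: "\<And>g. is_choice B g \<Longrightarrow> is_choice C (\<lambda>x. Option.bind (g (h x)) (\<lambda>w. k (x, w)))"
      unfolding reducible2_def by blast
    let ?k = "\<lambda>v. map_option proj (k v)"
    have "continuous_on (dom k) (\<lambda>v. proj (the (k v)))"
      using k unfolding partial_continuous_def by (rule continuous_proj)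
    moreover have "dom ?k = dom k" by (auto simp: dom_def)
    moreover have "continuous_on (dom k) (\<lambda>v. the (?k v)) \<longleftrightarrow> continuous_on (dom k) (\<lambda>v. proj (the (k v)))"
      by (rule continuous_on_cong) auto
    ultimately have "partial_continuous ?k" unfolding partial_continuous_def by simp
    moreover have "is_choice hard_set (\<lambda>x. Option.bind (g (h x)) (\<lambda>w. ?k (x, w)))" if g: "is_choice B g" for g
      unfolding is_choice_def
    proof (intro allI impI)
      fix x
      obtain u where "Option.bind (g (h x)) (\<lambda>w. k (x, w)) = Some u" "u \<in> sect C x"
        using red[OF g] \<open>total_set C\<close> unfolding is_choice_def total_set_def by blast
      then show "\<exists>y. Option.bind (g (h x)) (\<lambda>w. ?k (x, w)) = Some y \<and> y \<in> sect hard_set x"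
        using C(2) by (auto simp: bind_eq_Some_conv)
    qed
    ultimately show ?thesis unfolding reducible2_def using h by blast
  qed
  ultimately show ?thesis using C(1) hard_set_not_reducible by blast
qed

theorem theorem3p43:
  shows
    "(\<exists>A :: (baire \<times> baire) set.
        total_set A \<and> analytic A \<and> has_sections compact A \<and> has_sections homogeneous A \<and>
        (\<forall>B :: (baire \<times> baire) set.
           total_set B \<and> analytic B \<and> has_sections compact B \<longrightarrow> B \<le>\<^sub>1 A)) \<and>
     (\<forall>A :: (baire \<times> baire) set.
        total_set A \<and> analytic A \<and> has_sections closed A \<longrightarrow>
        (\<exists>B :: (baire \<times> baire) set.
           total_set B \<and> analytic B \<and> has_sections homogeneous B \<and> \<not> B \<le>\<^sub>2 A)) \<and>
     (\<exists>A :: (baire \<times> baire) set.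
        total_set A \<and> f_sigma_delta A \<and> has_sections gdelta A \<and>
        (\<forall>B :: (baire \<times> baire) set.
           analytic B \<and> has_sections closed B \<longrightarrow> \<not> A \<equiv>\<^sub>2 B)) \<and>
     (\<exists>A :: (baire \<times> baire) set.
        total_set A \<and> closed A \<and>
        (\<forall>B :: (baire \<times> baire) set.
           total_set B \<and> analytic B \<and> has_sections homogeneous B \<longrightarrow> \<not> A \<le>\<^sub>2 B))"
  using universal_compact_sections homogeneous_set_not_below gdelta_set_not_equivalent_to_closed_sections closed_set_not_below_homogeneous by blast

end
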